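(* The category $\mathsf{AtoMon}$ of atomic monoids and atom-preserving monoid homomorphisms is locally finitely presentable.
   Context: Monoids are not assumed to be commutative. For a monoid $H$, $H^\times$ denotes its group of units. A non-unit $a\in H$ is an atom if every equality $a=xy$ with $x,y\in H$ implies $x\in H^\times$ or $y\in H^\times$; $\mathcal{A}(H)$ denotes the set of atoms of $H$. The monoid $H$ is atomic if every non-unit of $H$ is a finite non-empty product of atoms. A homomorphism $f\colon H\to K$ between atomic monoids is atom-preserving if $f(\mathcal{A}(H))\subseteq\mathcal{A}(K)$. $\mathsf{AtoMon}$ is the category with objects the atomic monoids and morphisms the atom-preserving monoid homomorphisms. An object $X$ of a locally small category $\mathcal{C}$ with filtered colimits is compact if $\hom_{\mathcal{C}}(X,-)\colon\mathcal{C}\to\mathsf{Set}$ preserves filtered colimits. $\mathcal{C}$ is locally finitely presentable if it is cocomplete and there is a set $\mathcal{K}$ of compact objects such that every object of $\mathcal{C}$ is a filtered colimit of objects from $\mathcal{K}$. *)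

theory Defs
  imports "HOL-Algebra.Group"
begin

section \<open>Smallness\<close>

text \<open>
  Size is measured relative to a predicate \<open>small\<close> on the subsets of a type \<open>'u\<close>, which
  plays the role of a universe. The closure properties below are those of a Grothendieck
  universe (phrased for subsets of \<open>'u\<close>, up to bijection) except for closure under power sets,
  which is the separate predicate \<open>power_closed\<close>. Thus the small sets of a Grothendieck
  universe are one instance; another one, which exists in plain HOL, is an arbitrary
  infinite \<open>'u\<close> all of whose subsets are small, see \<open>smallness_all\<close>.
\<close>

definition smallness :: "('u set \<Rightarrow> bool) \<Rightarrow> bool" where
  "smallness small \<longleftrightarrow>
     (\<exists>A. infinite A \<and> small A) \<and>
     (\<forall>A B. small A \<longrightarrow> B \<subseteq> A \<longrightarrow> small B) \<and>
     (\<forall>A (f :: 'u \<Rightarrow> 'u). small A \<longrightarrow> small (f ` A)) \<and>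
     (\<forall>I (F :: 'u \<Rightarrow> 'u set). small I \<longrightarrow> (\<forall>i\<in>I. small (F i)) \<longrightarrow> small (\<Union>i\<in>I. F i))"

text \<open>Smallness for sets of elements of another type: being enumerated by a small set.\<close>

definition small_set :: "('u set \<Rightarrow> bool) \<Rightarrow> 'b set \<Rightarrow> bool" where
  "small_set small S \<longleftrightarrow> (\<exists>A f. small A \<and> S = f ` A)"

definition power_closed :: "('u set \<Rightarrow> bool) \<Rightarrow> bool" where
  "power_closed small \<longleftrightarrow> (\<forall>A. small A \<longrightarrow> small_set small (Pow A))"

lemma smallness_all: "infinite (UNIV :: 'u set) \<Longrightarrow> smallness (\<lambda>_ :: 'u set. True)"
  unfolding smallness_def by auto


section \<open>Categories, functors, colimits\<close>

text \<open>
  Hom-sets need not be disjoint, so identities, composition and the action of functors on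
  arrows carry the objects as arguments: \<open>cmp C X Y Z g f\<close> is \<open>g \<circ> f\<close> for
  \<open>f : X \<rightarrow> Y\<close> and \<open>g : Y \<rightarrow> Z\<close>.
\<close>

record ('o, 'm) cat =
  Obj :: "'o set"
  Hom :: "'o \<Rightarrow> 'o \<Rightarrow> 'm set"
  idt :: "'o \<Rightarrow> 'm"
  cmp :: "'o \<Rightarrow> 'o \<Rightarrow> 'o \<Rightarrow> 'm \<Rightarrow> 'm \<Rightarrow> 'm"

definition category :: "('o, 'm) cat \<Rightarrow> bool" where
  "category C \<longleftrightarrow>
     (\<forall>X\<in>Obj C. idt C X \<in> Hom C X X) \<and>
     (\<forall>X\<in>Obj C. \<forall>Y\<in>Obj C. \<forall>Z\<in>Obj C. \<forall>f\<in>Hom C X Y. \<forall>g\<in>Hom C Y Z.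
        cmp C X Y Z g f \<in> Hom C X Z) \<and>
     (\<forall>X\<in>Obj C. \<forall>Y\<in>Obj C. \<forall>f\<in>Hom C X Y.
        cmp C X X Y f (idt C X) = f \<and> cmp C X Y Y (idt C Y) f = f) \<and>
     (\<forall>W\<in>Obj C. \<forall>X\<in>Obj C. \<forall>Y\<in>Obj C. \<forall>Z\<in>Obj C.
        \<forall>f\<in>Hom C W X. \<forall>g\<in>Hom C X Y. \<forall>h\<in>Hom C Y Z.
        cmp C W X Z (cmp C X Y Z h g) f = cmp C W Y Z h (cmp C W X Y g f))"

record ('o, 'm, 'p, 'n) ftor =
  omap :: "'o \<Rightarrow> 'p"
  amap :: "'o \<Rightarrow> 'o \<Rightarrow> 'm \<Rightarrow> 'n"

definition is_functor :: "('o, 'm) cat \<Rightarrow> ('p, 'n) cat \<Rightarrow> ('o, 'm, 'p, 'n) ftor \<Rightarrow> bool" where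
  "is_functor J C D \<longleftrightarrow>
     category J \<and> category C \<and>
     (\<forall>i\<in>Obj J. omap D i \<in> Obj C) \<and>
     (\<forall>i\<in>Obj J. \<forall>j\<in>Obj J. \<forall>f\<in>Hom J i j. amap D i j f \<in> Hom C (omap D i) (omap D j)) \<and>
     (\<forall>i\<in>Obj J. amap D i i (idt J i) = idt C (omap D i)) \<and>
     (\<forall>i\<in>Obj J. \<forall>j\<in>Obj J. \<forall>k\<in>Obj J. \<forall>f\<in>Hom J i j. \<forall>g\<in>Hom J j k.
        amap D i k (cmp J i j k g f) =
          cmp C (omap D i) (omap D j) (omap D k) (amap D j k g) (amap D i j f))"

definition comp_functor ::
  "('p, 'n, 'q, 'l) ftor \<Rightarrow> ('o, 'm, 'p, 'n) ftor \<Rightarrow> ('o, 'm, 'q, 'l) ftor" where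
  "comp_functor F D =
     \<lparr>omap = (\<lambda>i. omap F (omap D i)),
      amap = (\<lambda>i j f. amap F (omap D i) (omap D j) (amap D i j f))\<rparr>"

definition is_cocone ::
  "('o, 'm) cat \<Rightarrow> ('p, 'n) cat \<Rightarrow> ('o, 'm, 'p, 'n) ftor \<Rightarrow> 'p \<Rightarrow> ('o \<Rightarrow> 'n) \<Rightarrow> bool" where
  "is_cocone J C D L c \<longleftrightarrow>
     L \<in> Obj C \<and>
     (\<forall>j\<in>Obj J. c j \<in> Hom C (omap D j) L) \<and>
     (\<forall>i\<in>Obj J. \<forall>j\<in>Obj J. \<forall>f\<in>Hom J i j.
        cmp C (omap D i) (omap D j) L (c j) (amap D i j f) = c i)"

definition is_colimit ::
  "('o, 'm) cat \<Rightarrow> ('p, 'n) cat \<Rightarrow> ('o, 'm, 'p, 'n) ftor \<Rightarrow> 'p \<Rightarrow> ('o \<Rightarrow> 'n) \<Rightarrow> bool" where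
  "is_colimit J C D L c \<longleftrightarrow>
     is_cocone J C D L c \<and>
     (\<forall>T t. is_cocone J C D T t \<longrightarrow>
        (\<exists>!h. h \<in> Hom C L T \<and> (\<forall>j\<in>Obj J. cmp C (omap D j) L T h (c j) = t j)))"

definition filtered :: "('o, 'm) cat \<Rightarrow> bool" where
  "filtered J \<longleftrightarrow>
     category J \<and> Obj J \<noteq> {} \<and>
     (\<forall>i\<in>Obj J. \<forall>j\<in>Obj J. \<exists>k\<in>Obj J. Hom J i k \<noteq> {} \<and> Hom J j k \<noteq> {}) \<and>
     (\<forall>i\<in>Obj J. \<forall>j\<in>Obj J. \<forall>f\<in>Hom J i j. \<forall>g\<in>Hom J i j.
        \<exists>k\<in>Obj J. \<exists>h\<in>Hom J j k. cmp J i j k h f = cmp J i j k h g)"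

text \<open>
  Every small category is isomorphic to one whose objects and arrows are elements of \<open>'u\<close>,
  so it suffices to index diagrams by those.
\<close>

definition small_cat :: "('u set \<Rightarrow> bool) \<Rightarrow> ('u, 'u) cat \<Rightarrow> bool" where
  "small_cat small J \<longleftrightarrow>
     category J \<and> small (Obj J) \<and> (\<forall>i\<in>Obj J. \<forall>j\<in>Obj J. small (Hom J i j))"

definition locally_small :: "('u set \<Rightarrow> bool) \<Rightarrow> ('o, 'm) cat \<Rightarrow> bool" where
  "locally_small small C \<longleftrightarrow> (\<forall>X\<in>Obj C. \<forall>Y\<in>Obj C. small_set small (Hom C X Y))"

definition cocomplete :: "('u set \<Rightarrow> bool) \<Rightarrow> ('o, 'm) cat \<Rightarrow> bool" where
  "cocomplete small C \<longleftrightarrow>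
     (\<forall>(J :: ('u, 'u) cat) D. small_cat small J \<longrightarrow> is_functor J C D \<longrightarrow>
        (\<exists>L c. is_colimit J C D L c))"

definition preserves_filtered_colimits ::
  "('u set \<Rightarrow> bool) \<Rightarrow> ('o, 'm) cat \<Rightarrow> ('p, 'n) cat \<Rightarrow> ('o, 'm, 'p, 'n) ftor \<Rightarrow> bool" where
  "preserves_filtered_colimits small C E F \<longleftrightarrow>
     (\<forall>(J :: ('u, 'u) cat) D L c.
        small_cat small J \<longrightarrow> filtered J \<longrightarrow> is_functor J C D \<longrightarrow> is_colimit J C D L c \<longrightarrow>
        is_colimit J E (comp_functor F D) (omap F L) (\<lambda>j. amap F (omap D j) L (c j)))"


section \<open>Compact objects and locally finitely presentable categories\<close>

text \<open>
  The category of sets is realised on the subsets of a type \<open>'b\<close>, with extensional functions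
  as arrows. It is used with \<open>'b\<close> the type of arrows of the category at hand, so that it contains all
  hom-sets. As soon as \<open>'b\<close> has two elements, a cocone of subsets of \<open>'b\<close> which is a
  colimit here is a colimit among all sets: whether the comparison map from the actual
  colimit is bijective is detected by maps into a two-element set.
\<close>

definition SetCat :: "('b set, 'b \<Rightarrow> 'b) cat" where
  "SetCat =
     \<lparr>Obj = UNIV,
      Hom = (\<lambda>A B. A \<rightarrow>\<^sub>E B),
      idt = (\<lambda>A. \<lambda>x\<in>A. x),
      cmp = (\<lambda>A B D g f. compose A g f)\<rparr>"

definition hom_functor :: "('o, 'm) cat \<Rightarrow> 'o \<Rightarrow> ('o, 'm, 'm set, 'm \<Rightarrow> 'm) ftor" where
  "hom_functor C X =
     \<lparr>omap = (\<lambda>Y. Hom C X Y),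
      amap = (\<lambda>Y Z g. \<lambda>f\<in>Hom C X Y. cmp C X Y Z g f)\<rparr>"

definition compact_object :: "('u set \<Rightarrow> bool) \<Rightarrow> ('o, 'm) cat \<Rightarrow> 'o \<Rightarrow> bool" where
  "compact_object small C X \<longleftrightarrow>
     X \<in> Obj C \<and> preserves_filtered_colimits small C SetCat (hom_functor C X)"

definition locally_finitely_presentable :: "('u set \<Rightarrow> bool) \<Rightarrow> ('o, 'm) cat \<Rightarrow> bool" where
  "locally_finitely_presentable small C \<longleftrightarrow>
     category C \<and> cocomplete small C \<and>
     (\<exists>K. small_set small K \<and> (\<forall>P\<in>K. compact_object small C P) \<and>
        (\<forall>X\<in>Obj C. \<exists>(J :: ('u, 'u) cat) D c.
           small_cat small J \<and> filtered J \<and> is_functor J C D \<and>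
           (\<forall>j\<in>Obj J. omap D j \<in> K) \<and> is_colimit J C D X c))"


section \<open>The category of atomic monoids\<close>

definition atoms :: "('a, 'b) monoid_scheme \<Rightarrow> 'a set" where
  "atoms H = {a \<in> carrier H - Units H.
     \<forall>x\<in>carrier H. \<forall>y\<in>carrier H. a = x \<otimes>\<^bsub>H\<^esub> y \<longrightarrow> x \<in> Units H \<or> y \<in> Units H}"

definition atomic_monoid :: "('a, 'b) monoid_scheme \<Rightarrow> bool" where
  "atomic_monoid H \<longleftrightarrow>
     monoid H \<and>
     (\<forall>x\<in>carrier H - Units H. \<exists>as. as \<noteq> [] \<and> set as \<subseteq> atoms H \<and>
        x = foldr (\<lambda>a b. a \<otimes>\<^bsub>H\<^esub> b) as \<one>\<^bsub>H\<^esub>)"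

text \<open>
  The library's \<open>hom\<close> does not require the identity to be preserved. Homomorphisms are
  normalised outside the carrier so that equality of arrows is equality on the carrier.
\<close>

definition atom_hom :: "('a, 'c) monoid_scheme \<Rightarrow> ('b, 'd) monoid_scheme \<Rightarrow> ('a \<Rightarrow> 'b) set" where
  "atom_hom H K = {f \<in> hom H K. f \<in> extensional (carrier H) \<and> f \<one>\<^bsub>H\<^esub> = \<one>\<^bsub>K\<^esub> \<and>
     f ` atoms H \<subseteq> atoms K}"

definition AtoMon :: "('u set \<Rightarrow> bool) \<Rightarrow> ('u monoid, 'u \<Rightarrow> 'u) cat" where
  "AtoMon small =
     \<lparr>Obj = {H. atomic_monoid H \<and> small (carrier H)},
      Hom = atom_hom,
      idt = (\<lambda>H. \<lambda>x\<in>carrier H. x),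
      cmp = (\<lambda>H K L g f. compose (carrier H) g f)\<rparr>"

end

theory Submission
  imports Defs "HOL-Library.Countable_Set"
begin

text \<open>
  In an atomic monoid \<open>x y = 1\<close> forces \<open>x\<close> and \<open>y\<close> to be units. Hence units, atoms and the remaining
  elements have degrees 0, 1 and 2 with \<open>deg (x y) = min 2 (deg x + deg y)\<close>, and the
  atom-preserving homomorphisms are exactly the degree-preserving ones. Conversely, a monoid with
  such a grading is atomic with this degree as soon as elements of degree 0 are units and elements
  of degree at most 1 generate. A presentation by graded letters and homogeneous relations
  therefore presents an atomic monoid, provided that letters of degree 0 are invertible; in
  particular colimits of atomic monoids are computed as for monoids. As usual, finitely presented
  objects are compact, and every atomic monoid is the directed colimit of its finite graded
  presentations by units and atoms.
\<close>

section \<open>Small sets\<close>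

text \<open>The cap at 2 reflects that an element of an atomic monoid may factor into different
  numbers of atoms, so beyond one atom no count is well defined in general. Truncation still detects
  atoms, since \<open>min 2 (m + n) = 1\<close> forces one of \<open>m\<close>, \<open>n\<close> to
  be 0 and the other to be 1. The obstacle is that a quotient of a free monoid may gain or lose
  units and atoms. Homogeneous relations keep the degrees apart, and inverses for letters of degree
  0 make degree 0 mean invertible. A third danger is a letter of degree 2 that no other word
  expresses: it would be irreducible, hence an atom. Colimit presentations contain letters of degree
  2, but each of them equals a product of atoms in its own monoid; the presentations that
  approximate a given monoid avoid degree 2 and adjoin every unit together with its inverse. Degrees
  cost nothing in the proof of compactness: the legs of a colimit preserve them, so letters lifted
  to a stage automatically have the right degree.\<close>

locale small_universe =
  fixes small :: "'u set \<Rightarrow> bool"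
  assumes smallness: "smallness small"
begin

lemma small_subset: "small A \<Longrightarrow> B \<subseteq> A \<Longrightarrow> small B"
  using smallness unfolding smallness_def by blast

lemma small_image: "small A \<Longrightarrow> small ((f :: 'u \<Rightarrow> 'u) ` A)"
  using smallness unfolding smallness_def by blast

lemma small_UN: "small I \<Longrightarrow> (\<And>i. i \<in> I \<Longrightarrow> small (F i)) \<Longrightarrow> small (\<Union>i\<in>I. F i)"
  for F :: "'u \<Rightarrow> 'u set"
  using smallness unfolding smallness_def by blast

lemma ex_infinite_small: obtains A where "infinite A" "small A"
  using smallness unfolding smallness_def by blast

text \<open>The axioms grant unions only over a small index set, so two points of an infinite small
  set are used to index \<open>A\<close> and \<open>B\<close>.\<close>

lemma small_Un:
  assumes "small A" "small B"
  shows "small (A \<union> B)"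
proof -
  obtain S where S: "infinite S" "small S" by (rule ex_infinite_small)
  then obtain a where a: "a \<in> S" by (metis ex_in_conv finite.emptyI)
  from S have "infinite (S - {a})" by simp
  then obtain b where b: "b \<in> S" "b \<noteq> a" by (metis Diff_iff ex_in_conv finite.emptyI insertI1)
  have "small {a, b}" using small_subset[OF S(2)] a b by auto
  from small_UN[OF this, of "\<lambda>i. if i = a then A else B"] assms
  have "small (\<Union>i\<in>{a, b}. if i = a then A else B)" by simp
  moreover have "(\<Union>i\<in>{a, b}. if i = a then A else B) = A \<union> B" using b by auto
  ultimately show ?thesis by simp
qed

lemma small_singleton: "small {a}"
proof -
  obtain S where S: "infinite S" "small S" by (rule ex_infinite_small)
  then have "(\<lambda>_. a) ` S = {a}" by (metis finite.emptyI image_constant_conv)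
  with small_image[OF S(2), of "\<lambda>_. a"] show ?thesis by simp
qed

lemma small_set_small: "small A \<Longrightarrow> small_set small A"
  unfolding small_set_def by (metis image_ident)

lemma small_set_image: "small_set small S \<Longrightarrow> small_set small (g ` S)"
  unfolding small_set_def by (metis image_image)

lemma small_set_subset:
  assumes "small_set small S" "T \<subseteq> S"
  shows "small_set small T"
proof -
  from assms(1) obtain A f where A: "small A" "S = f ` A" unfolding small_set_def by blast
  have "T = f ` (A \<inter> f -` T)" using assms(2) A(2) by auto
  moreover have "small (A \<inter> f -` T)" using small_subset[OF A(1)] by blast
  ultimately show ?thesis unfolding small_set_def by blast
qed

lemma small_set_surj: "small_set small S \<Longrightarrow> T \<subseteq> g ` S \<Longrightarrow> small_set small T"
  using small_set_image small_set_subset by blast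

text \<open>Choosing preimages under an enumeration embeds the set into \<open>'u\<close>. This is
  how words, which are not elements of \<open>'u\<close>, later yield a carrier inside
  \<open>'u\<close>.\<close>

lemma small_set_inj:
  fixes S :: "'b set"
  assumes "small_set small S"
  obtains e :: "'b \<Rightarrow> 'u" where "inj_on e S" "small (e ` S)"
proof -
  from assms obtain A f where A: "small A" "S = f ` A" unfolding small_set_def by blast
  have "inv_into A f ` S \<subseteq> A" using A(2) by (auto intro: inv_into_into)
  then show thesis
    using that[of "inv_into A f"] small_subset[OF A(1)] A(2) inj_on_inv_into by blast
qed

text \<open>The axioms do not mention pairs. Enlarging both indexing sets to one infinite small set
  \<open>U\<close> helps, because \<open>U \<times> U\<close> is equipotent with \<open>U\<close> by
  cardinal arithmetic.\<close>

lemma small_set_Times: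
  assumes "small_set small S" "small_set small T"
  shows "small_set small (S \<times> T)"
proof -
  from assms obtain A f B g where A: "small A" "S = f ` A" and B: "small B" "T = g ` B"
    unfolding small_set_def by blast
  obtain I where I: "infinite I" "small I" by (rule ex_infinite_small)
  define U where "U = A \<union> B \<union> I"
  have U: "small U" "infinite U" using small_Un A B I by (auto simp: U_def)
  then obtain p where "bij_betw p (U \<times> U) U" using card_of_Times_same_infinite card_of_ordIso by blast
  then have "U \<times> U = inv_into (U \<times> U) p ` U"
    by (metis bij_betw_def inv_into_image_cancel order_refl)
  then have "small_set small (U \<times> U)" using small_set_small[OF U(1)] small_set_image by metis
  moreover have "S \<times> T \<subseteq> map_prod f g ` (U \<times> U)" using A B by (auto simp: U_def)
  ultimately show ?thesis by (rule small_set_surj)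
qed

lemma small_set_UN:
  assumes "small_set small I" "\<And>i. i \<in> I \<Longrightarrow> small_set small (F i)"
  shows "small_set small (\<Union>i\<in>I. F i)"
proof -
  from assms(1) obtain A h where A: "small A" "I = h ` A" unfolding small_set_def by blast
  from assms(2) obtain B f where B: "\<And>i. i \<in> I \<Longrightarrow> small (B i) \<and> F i = f i ` B i"
    unfolding small_set_def by metis
  have "small (\<Union>a\<in>A. B (h a))" using A B by (intro small_UN) auto
  then have "small_set small (A \<times> (\<Union>a\<in>A. B (h a)))"
    using A small_set_Times small_set_small by blast
  moreover have "(\<Union>i\<in>I. F i) \<subseteq> (\<lambda>(a, b). f (h a) b) ` (A \<times> (\<Union>a\<in>A. B (h a)))"
    using A(2) B by force
  ultimately show ?thesis by (rule small_set_surj)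
qed

lemma small_set_countable:
  assumes "countable S"
  shows "small_set small S"
proof (cases "S = {}")
  case True
  then show ?thesis using small_set_subset[OF small_set_small[OF small_singleton]]
    by (metis bot.extremum small_set_image image_empty)
next
  case False
  obtain A where A: "infinite A" "small A" by (rule ex_infinite_small)
  then obtain f :: "nat \<Rightarrow> 'u" where f: "inj f" "range f \<subseteq> A" by (metis infinite_countable_subset)
  have "S = range (from_nat_into S)" using False assms by simp
  also have "\<dots> = (from_nat_into S \<circ> inv_into UNIV f) ` range f" using f(1) by (simp add: image_image)
  finally show ?thesis using small_subset[OF A(2) f(2)] unfolding small_set_def by blast
qed

text \<open>Words of a fixed length are iterated products, and the lengths form a countable, hence
  small, index set.\<close>

lemma small_set_lists:
  assumes "small_set small S"
  shows "small_set small (lists S)"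
proof -
  have "small_set small {w \<in> lists S. length w = n}" for n
  proof (induction n)
    case 0
    have "{w \<in> lists S. length w = 0} = {[]}" by auto
    then show ?case using small_set_countable[of "{[]}"] by simp
  next
    case (Suc n)
    have "{w \<in> lists S. length w = Suc n} \<subseteq> (\<lambda>(a, w). a # w) ` (S \<times> {w \<in> lists S. length w = n})"
      proof
      fix w assume "w \<in> {w \<in> lists S. length w = Suc n}"
      then show "w \<in> (\<lambda>(a, w). a # w) ` (S \<times> {w \<in> lists S. length w = n})"
        by (cases w) force+
    qed
    with small_set_Times[OF assms Suc] show ?case by (rule small_set_surj)
  qed
  then have "small_set small (\<Union>n\<in>UNIV. {w \<in> lists S. length w = n})"
    by (intro small_set_UN[OF small_set_countable[OF countableI_type]])
  moreover have "(\<Union>n\<in>UNIV. {w \<in> lists S. length w = n}) = lists S" by auto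
  ultimately show ?thesis by simp
qed

lemma small_set_finite_subsets:
  assumes "small_set small S"
  shows "small_set small {G. finite G \<and> G \<subseteq> S}"
proof -
  have "{G. finite G \<and> G \<subseteq> S} \<subseteq> set ` lists S"
    using finite_list by fastforce
  with small_set_lists[OF assms] show ?thesis by (rule small_set_surj)
qed

end

section \<open>The grading of an atomic monoid\<close>

definition grade :: "('a, 'b) monoid_scheme \<Rightarrow> 'a \<Rightarrow> nat" where
  "grade H x = (if x \<in> Units H then 0 else if x \<in> atoms H then 1 else 2)"

definition mprod :: "('a, 'b) monoid_scheme \<Rightarrow> 'a list \<Rightarrow> 'a" where
  "mprod H w = foldr (\<lambda>a b. a \<otimes>\<^bsub>H\<^esub> b) w \<one>\<^bsub>H\<^esub>"

lemma mprod_Nil [simp]: "mprod H [] = \<one>\<^bsub>H\<^esub>"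
  and mprod_Cons [simp]: "mprod H (a # w) = a \<otimes>\<^bsub>H\<^esub> mprod H w"
  by (simp_all add: mprod_def)

context monoid
begin

lemma mprod_closed [simp, intro]: "set w \<subseteq> carrier G \<Longrightarrow> mprod G w \<in> carrier G"
  by (induction w) auto

lemma mprod_append:
  "set v \<subseteq> carrier G \<Longrightarrow> set w \<subseteq> carrier G \<Longrightarrow> mprod G (v @ w) = mprod G v \<otimes> mprod G w"
  by (induction v) (auto simp: m_assoc)

lemma Units_factor:
  assumes "x \<in> carrier G" "y \<in> carrier G" "x \<otimes> y = \<one>" "z \<in> carrier G" "z \<otimes> x = \<one>"
  shows "x \<in> Units G"
  using assms inv_unique[of z x y] by (auto simp: Units_def)

end

lemma hom_mprod:
  assumes "monoid H" "f \<in> hom H K" "f \<one>\<^bsub>H\<^esub> = \<one>\<^bsub>K\<^esub>" "set w \<subseteq> carrier H"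
  shows "f (mprod H w) = mprod K (map f w)"
proof -
  interpret monoid H by fact
  show ?thesis using assms(2-4) by (induction w) (auto simp: hom_mult)
qed

lemma hom_Units:
  assumes "monoid H" "f \<in> hom H K" "f \<one>\<^bsub>H\<^esub> = \<one>\<^bsub>K\<^esub>" "x \<in> Units H"
  shows "f x \<in> Units K"
proof -
  from assms(4) obtain y where y: "x \<in> carrier H" "y \<in> carrier H"
    "y \<otimes>\<^bsub>H\<^esub> x = \<one>\<^bsub>H\<^esub>" "x \<otimes>\<^bsub>H\<^esub> y = \<one>\<^bsub>H\<^esub>"
    unfolding Units_def by blast
  then have "f y \<otimes>\<^bsub>K\<^esub> f x = \<one>\<^bsub>K\<^esub>" "f x \<otimes>\<^bsub>K\<^esub> f y = \<one>\<^bsub>K\<^esub>"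
    using assms(2,3) by (metis hom_mult)+
  then show ?thesis using y assms(2) hom_in_carrier unfolding Units_def by fast
qed

lemma atomsE:
  assumes "a \<in> atoms H" "x \<in> carrier H" "y \<in> carrier H" "a = x \<otimes>\<^bsub>H\<^esub> y"
  shows "x \<in> Units H \<or> y \<in> Units H"
  using assms unfolding atoms_def by blast

lemma atomsI:
  assumes "a \<in> carrier H" "a \<notin> Units H"
    "\<And>x y. x \<in> carrier H \<Longrightarrow> y \<in> carrier H \<Longrightarrow> a = x \<otimes>\<^bsub>H\<^esub> y \<Longrightarrow> x \<in> Units H \<or> y \<in> Units H"
  shows "a \<in> atoms H"
  using assms unfolding atoms_def by blast

lemma atoms_carrier: "a \<in> atoms H \<Longrightarrow> a \<in> carrier H"
  and atoms_nonunit: "a \<in> atoms H \<Longrightarrow> a \<notin> Units H"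
  unfolding atoms_def by auto

lemma grade_eq_0_iff [simp]: "grade H x = 0 \<longleftrightarrow> x \<in> Units H"
  by (simp add: grade_def)

lemma grade_eq_1_iff: "grade H x = 1 \<longleftrightarrow> x \<in> atoms H"
  by (auto simp: grade_def dest: atoms_nonunit)

lemma grade_le: "grade H x \<le> 2"
  by (simp add: grade_def)

locale atomic = monoid H for H (structure) +
  assumes nonunit_factorization:
    "x \<in> carrier H \<Longrightarrow> x \<notin> Units H \<Longrightarrow> \<exists>as. as \<noteq> [] \<and> set as \<subseteq> atoms H \<and> x = mprod H as"

lemma atomic_monoid_iff: "atomic_monoid H \<longleftrightarrow> atomic H"
  unfolding atomic_monoid_def atomic_def atomic_axioms_def mprod_def by auto

context atomic
begin

text \<open>An atom \<open>a\<close> satisfies \<open>a = (a x) y\<close> when \<open>x y = 1\<close>; hence one-sided inverses are two-sided.\<close>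

lemma right_invertible_Units:
  assumes x: "x \<in> carrier H" and y: "y \<in> carrier H" and xy: "x \<otimes> y = \<one>"
  shows "x \<in> Units H"
proof (rule ccontr)
  assume nu: "x \<notin> Units H"
  then obtain as where as: "as \<noteq> []" "set as \<subseteq> atoms H" using nonunit_factorization x by blast
  \<comment> \<open>Nothing ties \<open>a\<close> to \<open>x\<close>: the factorization of the
    nonunit \<open>x\<close> only serves to supply some atom.\<close>
  define a where "a = hd as"
  have a: "a \<in> atoms H" "a \<in> carrier H"
    using as by (auto simp: a_def intro!: atoms_carrier)
  have "a = (a \<otimes> x) \<otimes> y" using a x y xy by (simp add: m_assoc)
  then consider "a \<otimes> x \<in> Units H" | "y \<in> Units H"
    using atomsE[OF a(1)] a x y by blast
  then show False
  proof cases
    case 1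
    then obtain u where "u \<in> carrier H" "u \<otimes> (a \<otimes> x) = \<one>" unfolding Units_def by blast
    then have "u \<otimes> a \<in> carrier H" "(u \<otimes> a) \<otimes> x = \<one>" using a x by (auto simp: m_assoc)
    then show False using Units_factor x y xy nu by blast
  next
    case 2
    then obtain z where "z \<in> carrier H" "y \<otimes> z = \<one>" unfolding Units_def by blast
    then have "z = x" using inv_unique x y xy by metis
    then have "y \<otimes> x = \<one>" using \<open>y \<otimes> z = \<one>\<close> by simp
    then show False using nu x y xy unfolding Units_def by blast
  qed
qed

text \<open>A factor of a unit has a one-sided inverse, and \<open>right_invertible_Units\<close>
  upgrades it. For \<open>y\<close> the lemma is applied to the left inverse
  \<open>u \<otimes> x\<close> instead, whose inverse is then \<open>y\<close>.\<close>

lemma Units_mult_iff: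
  assumes x: "x \<in> carrier H" and y: "y \<in> carrier H"
  shows "x \<otimes> y \<in> Units H \<longleftrightarrow> x \<in> Units H \<and> y \<in> Units H"
proof
  assume "x \<otimes> y \<in> Units H"
  then obtain u where u: "u \<in> carrier H" "u \<otimes> (x \<otimes> y) = \<one>" "(x \<otimes> y) \<otimes> u = \<one>"
    unfolding Units_def by blast
  have "x \<in> Units H"
    using right_invertible_Units[of x "y \<otimes> u"] x y u by (simp add: m_assoc)
  moreover have "y \<in> Units H"
  proof -
    have ux: "u \<otimes> x \<in> Units H"
      using right_invertible_Units[of "u \<otimes> x" y] x y u by (simp add: m_assoc)
    have "inv (u \<otimes> x) \<otimes> ((u \<otimes> x) \<otimes> y) = (inv (u \<otimes> x) \<otimes> (u \<otimes> x)) \<otimes> y"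
      using Units_inv_closed[OF ux] x y u m_assoc[of "inv (u \<otimes> x)" "u \<otimes> x" y] by auto
    then have "y = inv (u \<otimes> x) \<otimes> ((u \<otimes> x) \<otimes> y)"
      using ux y by simp
    also have "\<dots> = inv (u \<otimes> x)" using Units_inv_closed[OF ux] x y u by (simp add: m_assoc)
    finally show ?thesis using Units_inv_Units[OF ux] by simp
  qed
  ultimately show "x \<in> Units H \<and> y \<in> Units H" by blast
qed auto

lemma Units_atom:
  assumes u: "u \<in> Units H" and a: "a \<in> atoms H"
  shows "u \<otimes> a \<in> atoms H"
proof (rule atomsI)
  have uc: "u \<in> carrier H" "inv u \<in> carrier H" and ac: "a \<in> carrier H"
    using u atoms_carrier[OF a] by auto
  show "u \<otimes> a \<in> carrier H" using uc ac by simp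
  show "u \<otimes> a \<notin> Units H" using Units_mult_iff uc ac atoms_nonunit[OF a] by blast
  fix x y assume xy: "x \<in> carrier H" "y \<in> carrier H" "u \<otimes> a = x \<otimes> y"
  have "a = inv u \<otimes> (u \<otimes> a)" using u uc ac m_assoc[of "inv u" u a] by simp
  also have "\<dots> = (inv u \<otimes> x) \<otimes> y" using xy uc by (simp add: m_assoc)
  finally have "inv u \<otimes> x \<in> Units H \<or> y \<in> Units H" using atomsE[OF a] xy uc by blast
  then show "x \<in> Units H \<or> y \<in> Units H" using Units_mult_iff xy uc by blast
qed

lemma atom_Units:
  assumes u: "u \<in> Units H" and a: "a \<in> atoms H"
  shows "a \<otimes> u \<in> atoms H"
proof (rule atomsI)
  have uc: "u \<in> carrier H" "inv u \<in> carrier H" and ac: "a \<in> carrier H"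
    using u atoms_carrier[OF a] by auto
  show "a \<otimes> u \<in> carrier H" using uc ac by simp
  show "a \<otimes> u \<notin> Units H" using Units_mult_iff uc ac atoms_nonunit[OF a] by blast
  fix x y assume xy: "x \<in> carrier H" "y \<in> carrier H" "a \<otimes> u = x \<otimes> y"
  have "a = (a \<otimes> u) \<otimes> inv u" using u uc ac by (simp add: m_assoc)
  also have "\<dots> = x \<otimes> (y \<otimes> inv u)" using xy uc by (simp add: m_assoc)
  finally have "x \<in> Units H \<or> y \<otimes> inv u \<in> Units H" using atomsE[OF a] xy uc by blast
  then show "x \<in> Units H \<or> y \<in> Units H" using Units_mult_iff xy uc by blast
qed

lemma Units_mult_atoms_iff:
  assumes u: "u \<in> Units H" and x: "x \<in> carrier H"
  shows "u \<otimes> x \<in> atoms H \<longleftrightarrow> x \<in> atoms H" "x \<otimes> u \<in> atoms H \<longleftrightarrow> x \<in> atoms H"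
proof -
  have uc: "u \<in> carrier H" "inv u \<in> Units H" "inv u \<in> carrier H" using u by auto
  have e: "inv u \<otimes> (u \<otimes> x) = x" "(x \<otimes> u) \<otimes> inv u = x"
    using u uc x m_assoc[of "inv u" u x] m_assoc[of x u "inv u"] by simp_all
  show "u \<otimes> x \<in> atoms H \<longleftrightarrow> x \<in> atoms H"
    using Units_atom[OF u, of x] Units_atom[OF uc(2), of "u \<otimes> x", unfolded e] by blast
  show "x \<otimes> u \<in> atoms H \<longleftrightarrow> x \<in> atoms H"
    using atom_Units[OF u, of x] atom_Units[OF uc(2), of "x \<otimes> u", unfolded e] by blast
qed

text \<open>A product of two nonunits is neither a unit nor an atom, which gives 2; if one factor is
  a unit, the product stays in the class of the other factor.\<close>

lemma grade_mult:
  assumes x: "x \<in> carrier H" and y: "y \<in> carrier H"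
  shows "grade H (x \<otimes> y) = min 2 (grade H x + grade H y)"
proof -
  have "x \<otimes> y \<notin> atoms H" if "x \<notin> Units H" "y \<notin> Units H"
    using that x y atomsE by metis
  then show ?thesis
    using x y Units_mult_iff Units_mult_atoms_iff by (auto simp: grade_def)
qed

lemma grade_mprod:
  "set w \<subseteq> carrier H \<Longrightarrow> grade H (mprod H w) = min 2 (sum_list (map (grade H) w))"
  by (induction w) (auto simp: grade_mult)

lemma ex_mprod_eq:
  assumes "x \<in> carrier H"
  obtains w where "set w \<subseteq> {a \<in> carrier H. grade H a \<le> 1}" "mprod H w = x"
proof (cases "x \<in> Units H")
  case True
  then show thesis using that[of "[x]"] assms by (simp add: grade_def)
next
  case False
  then obtain as where "set as \<subseteq> atoms H" "x = mprod H as"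
    using nonunit_factorization assms by blast
  moreover from this have "set as \<subseteq> {a \<in> carrier H. grade H a \<le> 1}"
    using atoms_carrier by (auto simp: grade_def)
  ultimately show thesis using that by blast
qed

text \<open>A factorization of \<open>x\<close> with a single entry would make \<open>x\<close> an
  atom, so two atoms can be split off.\<close>

lemma nonatom_factor:
  assumes "x \<in> carrier H" "grade H x = 2"
  obtains a b c where "a \<in> atoms H" "b \<in> atoms H" "c \<in> carrier H" "x = a \<otimes> (b \<otimes> c)"
proof -
  have "x \<notin> Units H" "x \<notin> atoms H" using assms(2) by (auto simp: grade_def split: if_splits)
  then obtain as where as: "as \<noteq> []" "set as \<subseteq> atoms H" "x = mprod H as"
    using nonunit_factorization assms by blast
  then obtain a r where ar: "as = a # r" by (cases as) auto
  have "r \<noteq> []"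
  proof
    assume "r = []"
    then have "x = a" using as ar by (auto dest: atoms_carrier)
    then show False using \<open>x \<notin> atoms H\<close> as ar by auto
  qed
  then obtain b s where bs: "r = b # s" by (cases r) auto
  have "set s \<subseteq> carrier H" using as(2) ar bs by (auto intro: atoms_carrier)
  then show thesis using that[of a b "mprod H s"] as ar bs by auto
qed

end

lemma atom_hom_iff:
  assumes "atomic H" "atomic K"
  shows "f \<in> atom_hom H K \<longleftrightarrow> f \<in> hom H K \<and> f \<in> extensional (carrier H) \<and> f \<one>\<^bsub>H\<^esub> = \<one>\<^bsub>K\<^esub> \<and>
    (\<forall>x\<in>carrier H. grade K (f x) = grade H x)"
proof -
  interpret H: atomic H by fact
  interpret K: atomic K by fact
  have "grade K (f x) = grade H x"
    if f: "f \<in> hom H K" "f \<one>\<^bsub>H\<^esub> = \<one>\<^bsub>K\<^esub>" "f ` atoms H \<subseteq> atoms K" and x: "x \<in> carrier H" for x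
  proof -
    consider "x \<in> Units H" | "x \<in> atoms H" | "grade H x = 2"
      unfolding grade_def by presburger
    then show ?thesis
    proof cases
      case 1
      then show ?thesis using hom_Units[OF H.monoid_axioms f(1,2)] by (simp add: grade_def)
    next
      case 2
      then have "f x \<in> atoms K" using f(3) by blast
      with 2 show ?thesis by (metis grade_eq_1_iff)
    next
      case 3
      with x obtain a b c where abc: "a \<in> atoms H" "b \<in> atoms H" "c \<in> carrier H"
        "x = a \<otimes>\<^bsub>H\<^esub> (b \<otimes>\<^bsub>H\<^esub> c)"
        using H.nonatom_factor by metis
      then have cl: "a \<in> carrier H" "b \<in> carrier H" "b \<otimes>\<^bsub>H\<^esub> c \<in> carrier H"
        by (auto intro: atoms_carrier)
      have 1: "grade K (f a) = 1" "grade K (f b) = 1"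
        using f(3) abc by (metis grade_eq_1_iff imageI subsetD)+
      have 2: "f a \<in> carrier K" "f b \<in> carrier K" "f c \<in> carrier K"
        using abc cl f(1) by (metis hom_in_carrier)+
      have "f x = f a \<otimes>\<^bsub>K\<^esub> (f b \<otimes>\<^bsub>K\<^esub> f c)"
        using abc cl f(1) by (metis hom_mult)
      \<comment> \<open>Whatever the degree of \<open>f c\<close> is, the two atoms
        \<open>f a\<close> and \<open>f b\<close> already bring the truncated sum to 2.\<close>
      then show ?thesis using 1 2 3 by (simp add: K.grade_mult)
    qed
  qed
  moreover have "f ` atoms H \<subseteq> atoms K" if "\<forall>x\<in>carrier H. grade K (f x) = grade H x"
    using that atoms_carrier by (metis grade_eq_1_iff image_subsetI)
  ultimately show ?thesis unfolding atom_hom_def by blast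
qed

text \<open>The sum rule decides both notions: a truncated sum is 0 only if both summands are, so
  units have degree 0, and it is 1 only if one summand is 0, so elements of degree 1 are
  irreducible. Atomicity then follows by clearing the units out of a generating word.\<close>

lemma graded_atomic:
  fixes H (structure) and \<gamma> :: "'a \<Rightarrow> nat"
  assumes "monoid H"
    and one: "\<gamma> \<one> = 0"
    and mult: "\<And>x y. x \<in> carrier H \<Longrightarrow> y \<in> carrier H \<Longrightarrow> \<gamma> (x \<otimes> y) = min 2 (\<gamma> x + \<gamma> y)"
    and unit: "\<And>x. x \<in> carrier H \<Longrightarrow> \<gamma> x = 0 \<Longrightarrow> x \<in> Units H"
    and gen: "\<And>x. x \<in> carrier H \<Longrightarrow>
      \<exists>w. set w \<subseteq> carrier H \<and> (\<forall>a\<in>set w. \<gamma> a \<le> 1) \<and> mprod H w = x"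
  shows "atomic H" "\<And>x. x \<in> carrier H \<Longrightarrow> grade H x = \<gamma> x"
proof -
  interpret monoid H by fact
  have Units_iff: "x \<in> Units H \<longleftrightarrow> \<gamma> x = 0" if "x \<in> carrier H" for x
  proof
    assume "x \<in> Units H"
    then obtain y where "y \<in> carrier H" "x \<otimes> y = \<one>" unfolding Units_def by blast
    then have "min 2 (\<gamma> x + \<gamma> y) = 0" using mult[of x y] that one by simp
    then show "\<gamma> x = 0" by simp
  qed (use unit that in auto)
  have atom: "x \<in> atoms H" if "x \<in> carrier H" "\<gamma> x = 1" for x
  proof (rule atomsI)
    fix y z assume "y \<in> carrier H" "z \<in> carrier H" "x = y \<otimes> z"
    then show "y \<in> Units H \<or> z \<in> Units H"
      using that(2) mult[of y z] Units_iff by auto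
  qed (use that Units_iff in auto)
  \<comment> \<open>Units are absorbed by a neighbouring atom: a letter of degree 0 is multiplied
    into the first atom after it, and an atom followed by a product of degree 0 swallows that
    product.\<close>
  have factor: "\<gamma> (mprod H w) = 0 \<or>
      (\<exists>as. as \<noteq> [] \<and> set as \<subseteq> {a \<in> carrier H. \<gamma> a = 1} \<and> mprod H w = mprod H as)"
    if "set w \<subseteq> carrier H" "\<forall>a\<in>set w. \<gamma> a \<le> 1" for w
    using that
  proof (induction w)
    case Nil
    then show ?case by (simp add: one)
  next
    case (Cons a w)
    then have a: "a \<in> carrier H" "\<gamma> a \<le> 1" and w: "mprod H w \<in> carrier H" by auto
    have "\<gamma> (mprod H w) = 0 \<or>
      (\<exists>as. as \<noteq> [] \<and> set as \<subseteq> {a \<in> carrier H. \<gamma> a = 1} \<and> mprod H w = mprod H as)"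
      using Cons.prems by (intro Cons.IH) auto
    then consider "\<gamma> (mprod H w) = 0"
      | b as where "set (b # as) \<subseteq> {a \<in> carrier H. \<gamma> a = 1}" "mprod H w = mprod H (b # as)"
      by (metis neq_Nil_conv)
    then show ?case
    proof cases
      case 1
      show ?thesis
      proof (cases "\<gamma> a = 0")
        case False
        then have "\<gamma> (a \<otimes> mprod H w) = 1" using 1 a w by (simp add: mult)
        then show ?thesis using a w by (intro disjI2 exI[of _ "[a \<otimes> mprod H w]"]) simp
      qed (use 1 a w in \<open>simp add: mult\<close>)
    next
      case 2
      then have b: "b \<in> carrier H" "\<gamma> b = 1" "set as \<subseteq> carrier H" by auto
      show ?thesis
      proof (cases "\<gamma> a = 0")
        case True
        then show ?thesis using 2 a b
          by (intro disjI2 exI[of _ "(a \<otimes> b) # as"]) (auto simp: mult m_assoc)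
      next
        case False
        then show ?thesis using 2 a by (intro disjI2 exI[of _ "a # b # as"]) auto
      qed
    qed
  qed
  have fac: "\<exists>as. as \<noteq> [] \<and> set as \<subseteq> {a \<in> carrier H. \<gamma> a = 1} \<and> x = mprod H as"
    if "x \<in> carrier H" "x \<notin> Units H" for x
    using gen[OF that(1)] factor that Units_iff by metis
  show "atomic H"
  proof
    fix x assume "x \<in> carrier H" "x \<notin> Units H"
    then obtain as where "as \<noteq> []" "set as \<subseteq> {a \<in> carrier H. \<gamma> a = 1}" "x = mprod H as"
      using fac by blast
    then show "\<exists>as. as \<noteq> [] \<and> set as \<subseteq> atoms H \<and> x = mprod H as"
      using atom by (intro exI[of _ as]) auto
  qed
  fix x assume x: "x \<in> carrier H"
  show "grade H x = \<gamma> x"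
  proof (cases "x \<in> Units H")
    case True
    then show ?thesis using Units_iff x by (simp add: grade_def)
  next
    case False
    then obtain as where as: "as \<noteq> []" "set as \<subseteq> {a \<in> carrier H. \<gamma> a = 1}" "x = mprod H as"
      using fac x by blast
    then obtain a r where ar: "as = a # r" by (cases as) auto
    show ?thesis
    proof (cases r)
      case Nil
      then have "\<gamma> x = 1" using as ar by auto
      then show ?thesis using atom x False by (simp add: grade_def)
    next
      case (Cons b s)
      have cl: "a \<in> carrier H" "\<gamma> a = 1" "b \<in> carrier H" "\<gamma> b = 1" "mprod H s \<in> carrier H"
        using as ar Cons by auto
      then have 2: "\<gamma> x = 2" using as ar Cons by (simp add: mult)
      have "a \<notin> Units H" "b \<otimes> mprod H s \<notin> Units H" using cl Units_iff by (auto simp: mult)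
      then have "x \<notin> atoms H" using atomsE[of x H a "b \<otimes> mprod H s"] as ar Cons cl by auto
      then show ?thesis using False 2 by (simp add: grade_def)
    qed
  qed
qed

section \<open>Graded presentations\<close>

text \<open>The congruence on the free monoid over \<open>G\<close> generated by \<open>R\<close>.
  The side conditions of \<open>rel\<close> ignore relations with a letter outside \<open>G\<close>,
  so that any \<open>R\<close> gives a congruence on \<open>lists G\<close>.\<close>

inductive pcong :: "'a set \<Rightarrow> ('a list \<times> 'a list) set \<Rightarrow> 'a list \<Rightarrow> 'a list \<Rightarrow> bool" for G R where
  refl: "w \<in> lists G \<Longrightarrow> pcong G R w w"
| rel: "(v, w) \<in> R \<Longrightarrow> v \<in> lists G \<Longrightarrow> w \<in> lists G \<Longrightarrow> pcong G R v w"
| sym: "pcong G R v w \<Longrightarrow> pcong G R w v"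
| trans: "pcong G R u v \<Longrightarrow> pcong G R v w \<Longrightarrow> pcong G R u w"
| append: "pcong G R v v' \<Longrightarrow> pcong G R w w' \<Longrightarrow> pcong G R (v @ w) (v' @ w')"

lemma pcong_lists: "pcong G R v w \<Longrightarrow> v \<in> lists G \<and> w \<in> lists G"
  by (induction rule: pcong.induct) auto

lemma pcong_mono:
  assumes "G \<subseteq> G'" "R \<subseteq> R'" "pcong G R v w"
  shows "pcong G' R' v w"
  using assms(3)
proof (induction rule: pcong.induct)
  case (refl w)
  then show ?case using assms(1) by (auto intro: pcong.refl)
next
  case (rel v w)
  then show ?case using assms(1,2) by (intro pcong.rel) auto
qed (auto intro: pcong.sym pcong.trans pcong.append)

lemma pcong_map:
  assumes "pcong G R v w"
  shows "pcong (\<phi> ` G) (map_prod (map \<phi>) (map \<phi>) ` R) (map \<phi> v) (map \<phi> w)"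
  using assms
proof (induction rule: pcong.induct)
  case (refl w)
  then show ?case by (intro pcong.refl) auto
next
  case (rel v w)
  then show ?case by (intro pcong.rel) force+
qed (auto intro: pcong.sym pcong.trans pcong.append)

text \<open>Evaluating words under \<open>f\<close> is a monoid homomorphism, so its kernel is a
  congruence, and this kernel contains the relations.\<close>

lemma pcong_mprod:
  assumes "monoid T" and f: "\<And>a. a \<in> G \<Longrightarrow> f a \<in> carrier T"
    and R: "\<And>v w. (v, w) \<in> R \<Longrightarrow> v \<in> lists G \<Longrightarrow> w \<in> lists G \<Longrightarrow>
      mprod T (map f v) = mprod T (map f w)"
    and "pcong G R v w"
  shows "mprod T (map f v) = mprod T (map f w)"
proof -
  interpret monoid T by fact
  show ?thesis using assms(4)
  proof (induction rule: pcong.induct)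
    case (append v v' w w')
    then have "set (map f u) \<subseteq> carrier T" if "u \<in> {v, v', w, w'}" for u
      using that f by (auto dest!: pcong_lists)
    with append show ?case by (simp add: mprod_append)
  qed (simp_all add: R)
qed

definition wgrade :: "('a \<Rightarrow> nat) \<Rightarrow> 'a list \<Rightarrow> nat" where
  "wgrade g w = min 2 (sum_list (map g w))"

lemma wgrade_append: "wgrade g (v @ w) = min 2 (wgrade g v + wgrade g w)"
  by (simp add: wgrade_def)

lemma wgrade_map: "wgrade g (map \<phi> w) = wgrade (g \<circ> \<phi>) w"
  by (simp add: wgrade_def)

lemma wgrade_cong: "(\<And>a. a \<in> set w \<Longrightarrow> g a = g' a) \<Longrightarrow> wgrade g w = wgrade g' w"
  unfolding wgrade_def by (metis map_cong)

lemma (in atomic) grade_mprod_map: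
  "(\<And>a. a \<in> set w \<Longrightarrow> f a \<in> carrier H) \<Longrightarrow> grade H (mprod H (map f w)) = wgrade (\<lambda>a. grade H (f a)) w"
  by (subst grade_mprod) (auto simp: wgrade_def comp_def)

text \<open>The three clauses ensure that the degree descends to the quotient, that degree 0 means
  invertible, and that letters of degree at most 1 generate. A free letter of degree 2 shows the
  need for the last one: it would be an atom. The inverse in the second clause is a word, not
  necessarily a letter.\<close>

definition good_pres :: "('a \<Rightarrow> nat) \<Rightarrow> 'a set \<Rightarrow> ('a list \<times> 'a list) set \<Rightarrow> bool" where
  "good_pres g G R \<longleftrightarrow>
     (\<forall>v\<in>lists G. \<forall>w\<in>lists G. (v, w) \<in> R \<longrightarrow> wgrade g v = wgrade g w) \<and>
     (\<forall>a\<in>G. g a = 0 \<longrightarrow> (\<exists>w. pcong G R (a # w) [] \<and> pcong G R (w @ [a]) [])) \<and>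
     (\<forall>a\<in>G. \<exists>w. (\<forall>b\<in>set w. g b \<le> 1) \<and> pcong G R [a] w)"

text \<open>\<open>M\<close> is the quotient of the free monoid over \<open>G\<close> by
  \<open>pcong G R\<close>. It is described through its class map \<open>q\<close> rather than by
  equivalence classes, because the carrier has to consist of elements of \<open>'u\<close>.\<close>

locale presented =
  fixes G :: "'a set" and R :: "('a list \<times> 'a list) set" and q :: "'a list \<Rightarrow> 'u"
    and M :: "'u monoid" (structure)
  assumes carrier_eq: "carrier M = q ` lists G"
    and q_Nil: "q [] = \<one>"
    and q_append: "\<And>v w. v \<in> lists G \<Longrightarrow> w \<in> lists G \<Longrightarrow> q (v @ w) = q v \<otimes> q w"
    and q_eq_iff: "\<And>v w. v \<in> lists G \<Longrightarrow> w \<in> lists G \<Longrightarrow> q v = q w \<longleftrightarrow> pcong G R v w"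
begin

lemma q_carrier: "w \<in> lists G \<Longrightarrow> q w \<in> carrier M"
  by (simp add: carrier_eq)

lemma carrierE:
  assumes "x \<in> carrier M"
  obtains w where "w \<in> lists G" "x = q w"
  using assms carrier_eq by auto

lemma monoid: "monoid M"
proof (rule monoidI)
  fix x y assume "x \<in> carrier M" "y \<in> carrier M"
  then obtain v w where "v \<in> lists G" "w \<in> lists G" "x = q v" "y = q w" by (metis carrierE)
  then show "x \<otimes> y \<in> carrier M" using q_carrier[of "v @ w"] by (simp add: q_append)
next
  fix x y z assume "x \<in> carrier M" "y \<in> carrier M" "z \<in> carrier M"
  then obtain u v w where "u \<in> lists G" "v \<in> lists G" "w \<in> lists G" "x = q u" "y = q v" "z = q w"
    by (metis carrierE)
  then show "(x \<otimes> y) \<otimes> z = x \<otimes> (y \<otimes> z)"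
    by (simp flip: q_append)
next
  fix x assume "x \<in> carrier M"
  then obtain w where w: "w \<in> lists G" "x = q w" by (rule carrierE)
  show "\<one> \<otimes> x = x" "x \<otimes> \<one> = x"
    using w q_append[of "[]" w] q_append[of w "[]"] by (simp_all add: q_Nil)
qed (use q_Nil q_carrier[of "[]"] in simp)

lemma mprod_q:
  assumes "w \<in> lists G"
  shows "mprod M (map (\<lambda>a. q [a]) w) = q w"
  using assms
proof (induction w rule: list.induct)
  case (Cons a w)
  then show ?case using q_append[of "[a]" w] by simp
qed (simp add: q_Nil)

lemma hom_q:
  assumes "h \<in> atom_hom M T" "w \<in> lists G"
  shows "h (q w) = mprod T (map (\<lambda>a. h (q [a])) w)"
proof -
  have "set (map (\<lambda>a. q [a]) w) \<subseteq> carrier M" using assms(2) q_carrier by auto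
  with assms show ?thesis
    using hom_mprod[OF monoid, of h T "map (\<lambda>a. q [a]) w"] mprod_q
    by (simp add: atom_hom_def comp_def)
qed

lemma hom_eqI:
  assumes "h \<in> atom_hom M T" "h' \<in> atom_hom M T" "\<And>a. a \<in> G \<Longrightarrow> h (q [a]) = h' (q [a])"
  shows "h = h'"
proof (rule extensionalityI)
  show "h \<in> extensional (carrier M)" "h' \<in> extensional (carrier M)"
    using assms(1,2) by (simp_all add: atom_hom_def)
  fix x assume "x \<in> carrier M"
  then obtain w where w: "w \<in> lists G" "x = q w" by (rule carrierE)
  then have "map (\<lambda>a. h (q [a])) w = map (\<lambda>a. h' (q [a])) w" using assms(3) by auto
  then show "h x = h' x" using hom_q assms(1,2) w by metis
qed

end

locale graded_presented = presented G R q M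
  for G :: "'a set" and R and q :: "'a list \<Rightarrow> 'u" and M (structure) +
  fixes g :: "'a \<Rightarrow> nat"
  assumes good: "good_pres g G R"
begin

lemma wgrade_pcong: "pcong G R v w \<Longrightarrow> wgrade g v = wgrade g w"
  by (induction rule: pcong.induct) (use good in \<open>auto simp: good_pres_def wgrade_append\<close>)

lemma reduce:
  assumes "w \<in> lists G"
  shows "\<exists>u. (\<forall>b\<in>set u. g b \<le> 1) \<and> pcong G R w u"
  using assms
proof (induction w rule: list.induct)
  case (Cons a w)
  then obtain u where u: "\<forall>b\<in>set u. g b \<le> 1" "pcong G R w u" by auto
  obtain t where t: "\<forall>b\<in>set t. g b \<le> 1" "pcong G R [a] t"
    using Cons.prems good by (auto simp: good_pres_def)
  have "pcong G R (a # w) (t @ u)" using pcong.append[OF t(2) u(2)] by simp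
  moreover have "\<forall>b\<in>set (t @ u). g b \<le> 1" using t u by auto
  ultimately show ?case by blast
qed (auto intro!: exI[of _ "[]"] pcong.refl)

lemma Units_q:
  assumes "w \<in> lists G" "wgrade g w = 0"
  shows "q w \<in> Units M"
proof -
  interpret monoid M by (rule monoid)
  show ?thesis using assms
  proof (induction w rule: list.induct)
    case (Cons a w)
    then have "g a + sum_list (map g w) = 0" by (simp add: wgrade_def min_def split: if_splits)
    then have 0: "g a = 0" "sum_list (map g w) = 0" by (simp_all only: add_is_0)
    have a: "a \<in> G" "g a = 0" and w: "w \<in> lists G" "wgrade g w = 0"
      unfolding wgrade_def 0 using Cons.prems(1) by simp_all
    then obtain u where u: "pcong G R (a # u) []" "pcong G R (u @ [a]) []"
      using good unfolding good_pres_def by blast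
    then have ul: "u \<in> lists G" using pcong_lists by fastforce
    have "q (a # u) = q []" "q (u @ [a]) = q []" using u a ul by (simp_all add: q_eq_iff)
    then have "q [a] \<otimes> q u = \<one>" "q u \<otimes> q [a] = \<one>"
      using a ul q_append[of "[a]" u] q_append[of u "[a]"] by (simp_all add: q_Nil)
    then have "q [a] \<in> Units M" using q_carrier[of "[a]"] q_carrier[OF ul] a unfolding Units_def by auto
    then have "q [a] \<otimes> q w \<in> Units M" using Cons.IH w by blast
    then show ?case using q_append[of "[a]" w] a w by simp
  qed (simp add: q_Nil)
qed

text \<open>By \<open>wgrade_pcong\<close> all words for the same element share one degree. It
  therefore descends to a function on \<open>M\<close>, and the hypotheses of
  \<open>graded_atomic\<close> become statements about words.\<close>

lemma atomic: "atomic M"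
  and grade_q: "w \<in> lists G \<Longrightarrow> grade M (q w) = wgrade g w"
proof -
  define \<gamma> where "\<gamma> x = wgrade g (SOME w. w \<in> lists G \<and> q w = x)" for x
  have \<gamma>: "\<gamma> (q w) = wgrade g w" if "w \<in> lists G" for w
  proof -
    define v where "v = (SOME v. v \<in> lists G \<and> q v = q w)"
    have "v \<in> lists G \<and> q v = q w" 
      using someI[of "\<lambda>v. v \<in> lists G \<and> q v = q w" w] that unfolding v_def by simp
    then have "pcong G R v w" using q_eq_iff that by blast
    then show ?thesis using wgrade_pcong by (simp add: \<gamma>_def flip: v_def)
  qed
  interpret monoid M by (rule monoid)
  have 1: "\<gamma> \<one> = 0" using \<gamma>[of "[]"] by (simp add: q_Nil wgrade_def)
  have 2: "\<gamma> (x \<otimes> y) = min 2 (\<gamma> x + \<gamma> y)" if "x \<in> carrier M" "y \<in> carrier M" for x y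
  proof -
    from that obtain v w where *: "v \<in> lists G" "w \<in> lists G" "x = q v" "y = q w" by (metis carrierE)
    then have "\<gamma> (x \<otimes> y) = wgrade g (v @ w)" using \<gamma>[of "v @ w"] q_append by simp
    then show ?thesis using * \<gamma> by (simp add: wgrade_append)
  qed
  have 3: "x \<in> Units M" if "x \<in> carrier M" "\<gamma> x = 0" for x
    using that \<gamma> Units_q by (metis carrierE)
  have 4: "\<exists>w. set w \<subseteq> carrier M \<and> (\<forall>a\<in>set w. \<gamma> a \<le> 1) \<and> mprod M w = x"
    if "x \<in> carrier M" for x
  proof -
    from that obtain w where w: "w \<in> lists G" "x = q w" by (rule carrierE)
    then obtain u where u: "\<forall>b\<in>set u. g b \<le> 1" "pcong G R w u" using reduce by blast
    have ul: "u \<in> lists G" using u(2) pcong_lists by blast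
    have "q w = q u" using q_eq_iff[OF w(1) ul] u(2) by simp
    then have "mprod M (map (\<lambda>a. q [a]) u) = x" using mprod_q[OF ul] w(2) by simp
    moreover have le: "\<gamma> (q [b]) \<le> 1" if "b \<in> set u" for b
      using that ul u(1) \<gamma>[of "[b]"] by (auto simp: wgrade_def)
    moreover have "set (map (\<lambda>a. q [a]) u) \<subseteq> carrier M" using ul q_carrier by auto
    moreover have "\<forall>a\<in>set (map (\<lambda>a. q [a]) u). \<gamma> a \<le> 1" using le by simp
    ultimately show ?thesis by metis
  qed
  show "atomic M"
    by (rule graded_atomic(1)[where \<gamma> = \<gamma>, OF monoid]; (rule 1 2 3 4; assumption))
  assume w: "w \<in> lists G"
  have "grade M (q w) = \<gamma> (q w)"
    by (rule graded_atomic(2)[where \<gamma> = \<gamma>, OF monoid _ _ _ _ q_carrier[OF w]];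
        (rule 1 2 3 4; assumption))
  then show "grade M (q w) = wgrade g w" using \<gamma>[OF w] by simp
qed

text \<open>The universal property among atomic monoids. The relations let evaluation descend to
  \<open>M\<close>; agreement of degrees on letters extends to words by the truncated sum, and this
  makes the resulting map atom-preserving.\<close>

lemma lift:
  assumes "atomic T"
    and f: "\<And>a. a \<in> G \<Longrightarrow> f a \<in> carrier T" "\<And>a. a \<in> G \<Longrightarrow> grade T (f a) = g a"
    and R: "\<And>v w. (v, w) \<in> R \<Longrightarrow> v \<in> lists G \<Longrightarrow> w \<in> lists G \<Longrightarrow>
      mprod T (map f v) = mprod T (map f w)"
  obtains h where "h \<in> atom_hom M T" "\<And>w. w \<in> lists G \<Longrightarrow> h (q w) = mprod T (map f w)"
proof -
  interpret T: atomic T by fact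
  define h where "h = (\<lambda>x\<in>carrier M. mprod T (map f (SOME w. w \<in> lists G \<and> q w = x)))"
  have h: "h (q w) = mprod T (map f w)" if "w \<in> lists G" for w
  proof -
    define v where "v = (SOME v. v \<in> lists G \<and> q v = q w)"
    have "v \<in> lists G \<and> q v = q w" 
      using someI[of "\<lambda>v. v \<in> lists G \<and> q v = q w" w] that unfolding v_def by simp
    then have "pcong G R v w" using q_eq_iff that by blast
    then have "mprod T (map f v) = mprod T (map f w)"
      using pcong_mprod[OF T.monoid_axioms, of G f R] f R by blast
    then show ?thesis using q_carrier[OF that] by (simp add: h_def flip: v_def)
  qed
  have fw: "set (map f w) \<subseteq> carrier T" if "w \<in> lists G" for w using that f by auto
  have "h \<in> hom M T"
  proof (rule homI)
    fix x assume "x \<in> carrier M"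
    then show "h x \<in> carrier T" using h fw by (metis T.mprod_closed carrierE)
  next
    fix x y assume "x \<in> carrier M" "y \<in> carrier M"
    then obtain v w where *: "v \<in> lists G" "w \<in> lists G" "x = q v" "y = q w" by (metis carrierE)
    then have "h (x \<otimes> y) = mprod T (map f (v @ w))" using h[of "v @ w"] q_append by simp
    also have "\<dots> = h x \<otimes>\<^bsub>T\<^esub> h y" using * h fw by (simp add: T.mprod_append)
    finally show "h (x \<otimes> y) = h x \<otimes>\<^bsub>T\<^esub> h y" .
  qed
  moreover have "h \<in> extensional (carrier M)" by (simp add: h_def)
  moreover have "h \<one> = \<one>\<^bsub>T\<^esub>" using h[of "[]"] by (simp add: q_Nil)
  moreover have "grade T (h x) = grade M x" if "x \<in> carrier M" for x
  proof -
    from that obtain w where w: "w \<in> lists G" "x = q w" by (rule carrierE)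
    then have "grade T (h x) = wgrade (\<lambda>a. grade T (f a)) w"
      using h f by (subst T.grade_mprod_map[symmetric]) auto
    also have "\<dots> = wgrade g w" using w f(2) by (intro wgrade_cong) auto
    finally show ?thesis using grade_q w by simp
  qed
  ultimately have "h \<in> atom_hom M T" using atom_hom_iff[OF atomic assms(1)] by blast
  with h show thesis using that by blast
qed

end

text \<open>The quotient is realised inside \<open>'u\<close> by one canonical word per class,
  encoded through an injection \<open>e\<close> of the small set of words. Multiplication
  concatenates words recovered by \<open>p\<close>.\<close>

lemma (in small_universe) ex_presented:
  fixes G :: "'a set"
  assumes "small_set small G"
  obtains q M where "presented G R q M" "small (carrier M)"
proof -
  from small_set_lists[OF assms] obtain e :: "'a list \<Rightarrow> 'u"
    where e: "inj_on e (lists G)" "small (e ` lists G)" by (rule small_set_inj)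
  define r where "r w = (SOME v. pcong G R w v)" for w
  have r: "pcong G R w (r w)" if "w \<in> lists G" for w
    unfolding r_def using pcong.refl[OF that] by (rule someI)
  have r_lists: "r w \<in> lists G" if "w \<in> lists G" for w using r[OF that] pcong_lists by blast
  have r_eq: "r v = r w \<longleftrightarrow> pcong G R v w" if "v \<in> lists G" "w \<in> lists G" for v w
  proof
    assume "r v = r w"
    then show "pcong G R v w" using r that by (metis pcong.sym pcong.trans)
  next
    assume "pcong G R v w"
    \<comment> \<open>The representative depends only on the predicate \<open>pcong G R w\<close>,
      and congruent words have equal predicates; hence the choice operator returns the same word for
      both.\<close>
    then have "pcong G R v u \<longleftrightarrow> pcong G R w u" for u by (meson pcong.sym pcong.trans)
    then have "pcong G R v = pcong G R w" by blast
    then show "r v = r w" by (simp add: r_def)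
  qed
  define q where "q w = e (r w)" for w
  have q_eq: "q v = q w \<longleftrightarrow> pcong G R v w" if "v \<in> lists G" "w \<in> lists G" for v w
    using that r_eq r_lists e(1) unfolding q_def by (metis inj_on_eq_iff)
  define p where "p = inv_into (lists G) q"
  have p: "p (q w) \<in> lists G" "pcong G R (p (q w)) w" if "w \<in> lists G" for w
  proof -
    show "p (q w) \<in> lists G" using that unfolding p_def by (intro inv_into_into) blast
    moreover have "q (p (q w)) = q w" using that unfolding p_def by (intro f_inv_into_f) blast
    ultimately show "pcong G R (p (q w)) w" using q_eq that by blast
  qed
  define M where "M = \<lparr>carrier = q ` lists G, mult = (\<lambda>x y. q (p x @ p y)), one = q []\<rparr>"
  have "presented G R q M"
  proof
    fix v w assume vw: "v \<in> lists G" "w \<in> lists G"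
    then have "pcong G R (p (q v) @ p (q w)) (v @ w)" using p by (intro pcong.append)
    then show "q (v @ w) = q v \<otimes>\<^bsub>M\<^esub> q w" using q_eq pcong_lists by (metis (no_types, lifting) M_def monoid.select_convs(1))
  qed (use q_eq in \<open>auto simp: M_def\<close>)
  moreover have "small (carrier M)"
    using r_lists by (intro small_subset[OF e(2)]) (auto simp: M_def q_def)
  ultimately show thesis by (rule that)
qed

section \<open>Colimits of atomic monoids\<close>

lemma AtoMon_simps [simp]:
  "Obj (AtoMon small) = {H. atomic H \<and> small (carrier H)}"
  "Hom (AtoMon small) H K = atom_hom H K"
  "idt (AtoMon small) H = (\<lambda>x\<in>carrier H. x)"
  "cmp (AtoMon small) H K L g f = compose (carrier H) g f"
  by (simp_all add: AtoMon_def atomic_monoid_iff)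

lemma atom_hom_carrier: "f \<in> atom_hom H K \<Longrightarrow> x \<in> carrier H \<Longrightarrow> f x \<in> carrier K"
  unfolding atom_hom_def by (auto intro: hom_in_carrier)

lemma atom_hom_mult: "f \<in> atom_hom H K \<Longrightarrow> x \<in> carrier H \<Longrightarrow> y \<in> carrier H \<Longrightarrow>
    f (x \<otimes>\<^bsub>H\<^esub> y) = f x \<otimes>\<^bsub>K\<^esub> f y"
  unfolding atom_hom_def by (auto intro: hom_mult)

lemma atom_hom_one: "f \<in> atom_hom H K \<Longrightarrow> f \<one>\<^bsub>H\<^esub> = \<one>\<^bsub>K\<^esub>"
  unfolding atom_hom_def by blast

lemma atom_hom_mprod: "monoid H \<Longrightarrow> f \<in> atom_hom H K \<Longrightarrow> set w \<subseteq> carrier H \<Longrightarrow>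
    f (mprod H w) = mprod K (map f w)"
  unfolding atom_hom_def by (auto intro: hom_mprod)

lemma atom_hom_grade: "atomic H \<Longrightarrow> atomic K \<Longrightarrow> f \<in> atom_hom H K \<Longrightarrow> x \<in> carrier H \<Longrightarrow>
    grade K (f x) = grade H x"
  using atom_hom_iff by blast

lemma atom_hom_eqI:
  assumes "f \<in> atom_hom H K" "g \<in> atom_hom H L" "\<And>x. x \<in> carrier H \<Longrightarrow> f x = g x"
  shows "f = g"
  using assms by (intro extensionalityI[of f "carrier H" g]) (auto simp: atom_hom_def)

lemma atom_homI:
  assumes "atomic H" "atomic K"
    and "\<And>x. x \<in> carrier H \<Longrightarrow> f x \<in> carrier K"
    and "\<And>x y. x \<in> carrier H \<Longrightarrow> y \<in> carrier H \<Longrightarrow> f (x \<otimes>\<^bsub>H\<^esub> y) = f x \<otimes>\<^bsub>K\<^esub> f y"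
    and "f \<one>\<^bsub>H\<^esub> = \<one>\<^bsub>K\<^esub>"
    and "\<And>x. x \<in> carrier H \<Longrightarrow> grade K (f x) = grade H x"
  shows "restrict f (carrier H) \<in> atom_hom H K"
proof -
  interpret atomic H by fact
  show ?thesis using assms unfolding atom_hom_iff[OF assms(1,2)] by (auto intro!: homI)
qed

lemma atom_hom_compose:
  assumes "monoid H" "f \<in> atom_hom H K" "g \<in> atom_hom K L"
  shows "compose (carrier H) g f \<in> atom_hom H L"
proof -
  interpret monoid H by fact
  have "g (f a) \<in> atoms L" if "a \<in> atoms H" for a
    using that assms(2,3) unfolding atom_hom_def by blast
  then show ?thesis
    using assms(2,3) atom_hom_carrier[OF assms(2)] atom_hom_carrier[OF assms(3)]
    unfolding atom_hom_def
    by (auto intro!: homI simp: compose_def hom_mult atoms_carrier)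
qed

lemma atom_hom_id: "monoid H \<Longrightarrow> (\<lambda>x\<in>carrier H. x) \<in> atom_hom H H"
  unfolding atom_hom_def
  by (auto intro!: homI simp: atoms_carrier monoid.m_closed monoid.one_closed)

lemma atomic_imp_monoid: "atomic H \<Longrightarrow> monoid H"
  by (simp add: atomic_def)

lemma category_AtoMon: "category (AtoMon small)"
  unfolding category_def AtoMon_simps
proof (intro conjI ballI)
  fix W X Y Z f g h
  assume *: "W \<in> {H. atomic H \<and> small (carrier H)}"
    "f \<in> atom_hom W X" "g \<in> atom_hom X Y" "h \<in> atom_hom Y Z"
  show "compose (carrier W) (compose (carrier X) h g) f
      = compose (carrier W) h (compose (carrier W) g f)"
    using atom_hom_carrier[OF *(2)] by (auto simp: compose_def fun_eq_iff)
next
  fix X Y f assume *: "f \<in> atom_hom X Y"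
  then have "f \<in> extensional (carrier X)" by (simp add: atom_hom_def)
  then show "compose (carrier X) f (\<lambda>x\<in>carrier X. x) = f"
    "compose (carrier X) (\<lambda>x\<in>carrier Y. x) f = f"
    using atom_hom_carrier[OF *] by (auto simp: compose_def fun_eq_iff extensional_def)
qed (auto intro: atom_hom_compose atom_hom_id atomic_imp_monoid)

section \<open>The presentation of the colimit of a small diagram\<close>

locale diagram = small_universe small for small :: "'u set \<Rightarrow> bool" +
  fixes J :: "('u, 'u) cat" and D :: "('u, 'u, 'u monoid, 'u \<Rightarrow> 'u) ftor"
  assumes small_J: "small_cat small J" and D_functor: "is_functor J (AtoMon small) D"
begin

lemma category_J: "category J"
  using small_J by (simp add: small_cat_def)

lemma idt_J: "i \<in> Obj J \<Longrightarrow> idt J i \<in> Hom J i i"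
  using category_J unfolding category_def by blast

lemma cmp_J: "i \<in> Obj J \<Longrightarrow> j \<in> Obj J \<Longrightarrow> k \<in> Obj J \<Longrightarrow> f \<in> Hom J i j \<Longrightarrow> g \<in> Hom J j k \<Longrightarrow>
    cmp J i j k g f \<in> Hom J i k"
  using category_J unfolding category_def by blast

lemma obj: "i \<in> Obj J \<Longrightarrow> atomic (omap D i)" "i \<in> Obj J \<Longrightarrow> small (carrier (omap D i))"
  using D_functor unfolding is_functor_def by simp_all

lemma arr: "i \<in> Obj J \<Longrightarrow> j \<in> Obj J \<Longrightarrow> f \<in> Hom J i j \<Longrightarrow>
    amap D i j f \<in> atom_hom (omap D i) (omap D j)"
  using D_functor unfolding is_functor_def by simp

lemma arr_closed: "i \<in> Obj J \<Longrightarrow> j \<in> Obj J \<Longrightarrow> f \<in> Hom J i j \<Longrightarrow> x \<in> carrier (omap D i) \<Longrightarrow>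
    amap D i j f x \<in> carrier (omap D j)"
  using arr by (rule atom_hom_carrier)

lemma arr_idt: "i \<in> Obj J \<Longrightarrow> x \<in> carrier (omap D i) \<Longrightarrow> amap D i i (idt J i) x = x"
  using D_functor unfolding is_functor_def by simp

lemma arr_cmp: "i \<in> Obj J \<Longrightarrow> j \<in> Obj J \<Longrightarrow> k \<in> Obj J \<Longrightarrow> f \<in> Hom J i j \<Longrightarrow> g \<in> Hom J j k \<Longrightarrow>
    x \<in> carrier (omap D i) \<Longrightarrow>
    amap D i k (cmp J i j k g f) x = amap D j k g (amap D i j f x)"
  using D_functor unfolding is_functor_def by (simp add: compose_def)

definition letters :: "('u \<times> 'u) set" where
  "letters = (SIGMA j:Obj J. carrier (omap D j))"

definition lgrade :: "'u \<times> 'u \<Rightarrow> nat" where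
  "lgrade = (\<lambda>(j, x). grade (omap D j) x)"

text \<open>The usual presentation of a colimit of monoids: all multiplication tables, together with
  the identification of elements along arrows. All these relations are homogeneous, the last kind
  because arrows preserve degrees.\<close>

inductive_set rels :: "(('u \<times> 'u) list \<times> ('u \<times> 'u) list) set" where
  mult: "j \<in> Obj J \<Longrightarrow> x \<in> carrier (omap D j) \<Longrightarrow> y \<in> carrier (omap D j) \<Longrightarrow>
    ([(j, x), (j, y)], [(j, x \<otimes>\<^bsub>omap D j\<^esub> y)]) \<in> rels"
| one: "j \<in> Obj J \<Longrightarrow> ([(j, \<one>\<^bsub>omap D j\<^esub>)], []) \<in> rels"
| arrow: "i \<in> Obj J \<Longrightarrow> j \<in> Obj J \<Longrightarrow> f \<in> Hom J i j \<Longrightarrow> x \<in> carrier (omap D i) \<Longrightarrow>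
    ([(i, x)], [(j, amap D i j f x)]) \<in> rels"

lemma letters_iff [simp]: "(j, x) \<in> letters \<longleftrightarrow> j \<in> Obj J \<and> x \<in> carrier (omap D j)"
  by (simp add: letters_def)

lemma small_letters: "small_set small letters"
proof -
  have "small_set small (Obj J)" using small_J small_set_small by (simp add: small_cat_def)
  moreover from this have "small_set small (\<Union>j\<in>Obj J. carrier (omap D j))"
    by (rule small_set_UN) (intro small_set_small obj)
  ultimately have "small_set small (Obj J \<times> (\<Union>j\<in>Obj J. carrier (omap D j)))"
    by (rule small_set_Times)
  then show ?thesis by (rule small_set_subset) (auto simp: letters_def)
qed

lemma mult_pcong:
  assumes "j \<in> Obj J" "x \<in> carrier (omap D j)" "y \<in> carrier (omap D j)"
  shows "pcong letters rels [(j, x), (j, y)] [(j, x \<otimes>\<^bsub>omap D j\<^esub> y)]"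
proof -
  interpret atomic "omap D j" using obj assms(1) by blast
  show ?thesis using assms by (intro pcong.rel rels.mult) auto
qed

lemma one_pcong:
  assumes "j \<in> Obj J"
  shows "pcong letters rels [(j, \<one>\<^bsub>omap D j\<^esub>)] []"
proof -
  interpret atomic "omap D j" using obj assms(1) by blast
  show ?thesis using assms by (intro pcong.rel rels.one) auto
qed

lemma arrow_pcong:
  assumes "i \<in> Obj J" "j \<in> Obj J" "f \<in> Hom J i j" "x \<in> carrier (omap D i)"
  shows "pcong letters rels [(i, x)] [(j, amap D i j f x)]"
  using assms arr_closed by (intro pcong.rel rels.arrow) auto

text \<open>Iterating the multiplication table evaluates whole words. Read backwards, this rewrites
  a letter of degree 2 as a word of letters of degree at most 1, as \<open>good_pres\<close>
  demands.\<close>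

lemma mprod_pcong:
  assumes "j \<in> Obj J" "set w \<subseteq> carrier (omap D j)"
  shows "pcong letters rels [(j, mprod (omap D j) w)] (map (Pair j) w)"
proof -
  interpret atomic "omap D j" using obj assms(1) by blast
  show ?thesis using assms(2)
  proof (induction w rule: list.induct)
    case Nil
    then show ?case using one_pcong assms(1) by simp
  next
    case (Cons a w)
    then have a: "a \<in> carrier (omap D j)" and w: "mprod (omap D j) w \<in> carrier (omap D j)" by auto
    have "pcong letters rels ([(j, a)] @ [(j, mprod (omap D j) w)]) ([(j, a)] @ map (Pair j) w)"
      using Cons a assms(1) by (intro pcong.append pcong.refl) auto
    then show ?case using mult_pcong[OF assms(1) a w] by (auto intro: pcong.sym pcong.trans)
  qed
qed

lemma good_letters: "good_pres lgrade letters rels"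
  unfolding good_pres_def
proof (intro conjI ballI impI)
  fix v w :: "('u \<times> 'u) list" assume "(v, w) \<in> rels"
  then show "wgrade lgrade v = wgrade lgrade w"
  proof cases
    case (mult j x y)
    then interpret atomic "omap D j" using obj by blast
    show ?thesis using mult by (simp add: wgrade_def lgrade_def grade_mult)
  next
    case (one j)
    then interpret atomic "omap D j" using obj by blast
    show ?thesis using one by (simp add: wgrade_def lgrade_def grade_def)
  next
    case (arrow i j f x)
    then show ?thesis using atom_hom_grade[OF obj(1) obj(1) arr]
      by (simp add: wgrade_def lgrade_def)
  qed
next
  fix a assume a: "a \<in> letters" "lgrade a = 0"
  obtain j x where jx: "a = (j, x)" by fastforce
  with a have x: "j \<in> Obj J" "x \<in> Units (omap D j)" by (simp_all add: lgrade_def)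
  then obtain y where y: "x \<in> carrier (omap D j)" "y \<in> carrier (omap D j)"
    "y \<otimes>\<^bsub>omap D j\<^esub> x = \<one>\<^bsub>omap D j\<^esub>" "x \<otimes>\<^bsub>omap D j\<^esub> y = \<one>\<^bsub>omap D j\<^esub>"
    unfolding Units_def by blast
  have "pcong letters rels [(j, x), (j, y)] []" "pcong letters rels [(j, y), (j, x)] []"
    using mult_pcong[of j x y] mult_pcong[of j y x] one_pcong[of j] x y
    by (auto intro: pcong.trans)
  then show "\<exists>w. pcong letters rels (a # w) [] \<and> pcong letters rels (w @ [a]) []"
    using jx by (intro exI[of _ "[(j, y)]"]) simp
next
  fix a assume a: "a \<in> letters"
  obtain j x where jx: "a = (j, x)" by fastforce
  with a have x: "j \<in> Obj J" "x \<in> carrier (omap D j)" by simp_all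
  interpret atomic "omap D j" using obj x by blast
  obtain w where w: "set w \<subseteq> {a \<in> carrier (omap D j). grade (omap D j) a \<le> 1}"
    "mprod (omap D j) w = x"
    using ex_mprod_eq x by blast
  then have "pcong letters rels [a] (map (Pair j) w)" using mprod_pcong[OF x(1), of w] jx by auto
  then show "\<exists>w. (\<forall>b\<in>set w. lgrade b \<le> 1) \<and> pcong letters rels [a] w"
    using w(1) by (intro exI[of _ "map (Pair j) w"]) (auto simp: lgrade_def)
qed

definition coproj :: "(('u \<times> 'u) list \<Rightarrow> 'u) \<Rightarrow> 'u \<Rightarrow> 'u \<Rightarrow> 'u" where
  "coproj q j = (\<lambda>x\<in>carrier (omap D j). q [(j, x)])"

text \<open>A cocone to an atomic monoid is the same thing as a degree-preserving assignment on
  letters that respects \<open>rels\<close>, so the universal property of the presentation is that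
  of the colimit.\<close>

lemma presented_colimit:
  assumes "presented letters rels q M" "small (carrier M)"
  shows "is_colimit J (AtoMon small) D M (coproj q)"
proof -
  interpret graded_presented letters rels q M lgrade
    using assms(1) good_letters by (simp add: graded_presented_def graded_presented_axioms_def)
  have coproj: "coproj q j \<in> atom_hom (omap D j) M" if j: "j \<in> Obj J" for j
    unfolding coproj_def
  proof (rule atom_homI)
    fix x y assume xy: "x \<in> carrier (omap D j)" "y \<in> carrier (omap D j)"
    interpret atomic "omap D j" using obj j by blast
    have "q [(j, x \<otimes>\<^bsub>omap D j\<^esub> y)] = q [(j, x), (j, y)]"
      using q_eq_iff[of "[(j, x), (j, y)]" "[(j, x \<otimes>\<^bsub>omap D j\<^esub> y)]"] mult_pcong j xy by simp
    then show "q [(j, x \<otimes>\<^bsub>omap D j\<^esub> y)] = q [(j, x)] \<otimes>\<^bsub>M\<^esub> q [(j, y)]"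
      using q_append[of "[(j, x)]" "[(j, y)]"] j xy by simp
  next
    interpret atomic "omap D j" using obj j by blast
    show "q [(j, \<one>\<^bsub>omap D j\<^esub>)] = \<one>\<^bsub>M\<^esub>"
      using q_eq_iff[of "[(j, \<one>\<^bsub>omap D j\<^esub>)]" "[]"] one_pcong j by (simp add: q_Nil)
  next
    fix x assume "x \<in> carrier (omap D j)"
    \<comment> \<open>A one-letter word has the truncated degree of its letter;
      \<open>grade_le\<close> shows that truncation changes nothing.\<close>
    then show "grade M (q [(j, x)]) = grade (omap D j) x"
      using grade_q[of "[(j, x)]"] j grade_le[of "omap D j" x] by (simp add: wgrade_def lgrade_def)
  qed (use j obj atomic q_carrier in auto)
  have "is_cocone J (AtoMon small) D M (coproj q)"
    unfolding is_cocone_def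
  proof (intro conjI ballI)
    show "M \<in> Obj (AtoMon small)" using atomic assms(2) by simp
  next
    fix i j f assume *: "i \<in> Obj J" "j \<in> Obj J" "f \<in> Hom J i j"
    have "q [(j, amap D i j f x)] = q [(i, x)]" if "x \<in> carrier (omap D i)" for x
      using q_eq_iff[of "[(i, x)]" "[(j, amap D i j f x)]"] arrow_pcong[OF * that]
        pcong_lists[OF arrow_pcong[OF * that]] by simp
    then show "cmp (AtoMon small) (omap D i) (omap D j) M (coproj q j) (amap D i j f) = coproj q i"
      using atom_hom_carrier[OF arr[OF *]] by (auto simp: coproj_def compose_def fun_eq_iff)
  qed (use coproj in simp)
  moreover have "\<exists>!h. h \<in> Hom (AtoMon small) M T \<and>
      (\<forall>j\<in>Obj J. cmp (AtoMon small) (omap D j) M T h (coproj q j) = t j)"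
    if cocone: "is_cocone J (AtoMon small) D T t" for T t
  proof -
    have T: "atomic T" and t: "\<And>j. j \<in> Obj J \<Longrightarrow> t j \<in> atom_hom (omap D j) T"
      and tt: "\<And>i j f. i \<in> Obj J \<Longrightarrow> j \<in> Obj J \<Longrightarrow> f \<in> Hom J i j \<Longrightarrow>
        compose (carrier (omap D i)) (t j) (amap D i j f) = t i"
      using cocone by (auto simp: is_cocone_def)
    interpret T: atomic T by fact
    define f where "f = (\<lambda>(j, x). t j x)"
    have ft: "f a \<in> carrier T" if "a \<in> letters" for a
      using that t atom_hom_carrier by (force simp: f_def letters_def)
    obtain h where h: "h \<in> atom_hom M T" "\<And>w. w \<in> lists letters \<Longrightarrow> h (q w) = mprod T (map f w)"
    proof (rule lift[OF T])
      show "f a \<in> carrier T" if "a \<in> letters" for a using that ft by blast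
      show "grade T (f a) = lgrade a" if "a \<in> letters" for a
      proof (cases a)
        case (Pair j x)
        with that show ?thesis
          using atom_hom_grade[OF obj(1) T t] by (simp add: f_def lgrade_def)
      qed
      fix v w assume vw: "v \<in> lists letters" "w \<in> lists letters" and "(v, w) \<in> rels"
      then have "set (map f v) \<subseteq> carrier T" "set (map f w) \<subseteq> carrier T" using ft by auto
      with \<open>(v, w) \<in> rels\<close> show "mprod T (map f v) = mprod T (map f w)"
      proof cases
        case (arrow i j g x)
        then have "t j (amap D i j g x) = t i x" using tt[of i j g] by (metis compose_eq)
        then show ?thesis using arrow by (simp add: f_def)
      next
        case (mult j x y)
        then show ?thesis using atom_hom_mult[OF t] atom_hom_carrier[OF t]
          by (simp add: f_def T.m_assoc)
      next
        case (one j)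
        then show ?thesis using atom_hom_one[OF t] by (simp add: f_def)
      qed
    qed (rule that)
    show ?thesis
    proof (rule ex1I[of _ h])
      have "compose (carrier (omap D j)) h (coproj q j) = t j" if j: "j \<in> Obj J" for j
      proof -
        have ext: "t j \<in> extensional (carrier (omap D j))" using t[OF j] by (simp add: atom_hom_def)
        show ?thesis
        proof (rule extensionalityI[OF _ ext])
          fix x assume x: "x \<in> carrier (omap D j)"
          then have "h (q [(j, x)]) = t j x \<otimes>\<^bsub>T\<^esub> \<one>\<^bsub>T\<^esub>" using h(2)[of "[(j, x)]"] j by (simp add: f_def)
          then show "compose (carrier (omap D j)) h (coproj q j) x = t j x"
            using x atom_hom_carrier[OF t[OF j] x] by (simp add: compose_def coproj_def)
        qed (simp add: compose_extensional)
      qed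
      then show "h \<in> Hom (AtoMon small) M T \<and>
          (\<forall>j\<in>Obj J. cmp (AtoMon small) (omap D j) M T h (coproj q j) = t j)"
        using h(1) by simp
      fix k assume k: "k \<in> Hom (AtoMon small) M T \<and>
          (\<forall>j\<in>Obj J. cmp (AtoMon small) (omap D j) M T k (coproj q j) = t j)"
      have "k (q [(j, x)]) = h (q [(j, x)])" if "(j, x) \<in> letters" for j x
      proof -
        from that have *: "j \<in> Obj J" "x \<in> carrier (omap D j)" by simp_all
        then have "k (q [(j, x)]) = compose (carrier (omap D j)) k (coproj q j) x"
          by (simp add: compose_def coproj_def)
        also have "\<dots> = t j x" using k * by simp
        finally show ?thesis using h(2)[of "[(j, x)]"] * atom_hom_carrier[OF t] by (simp add: f_def)
      qed
      then show "k = h" using k h(1) by (intro hom_eqI[of k T h]) auto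
    qed
  qed
  ultimately show ?thesis by (simp add: is_colimit_def)
qed

lemma ex_colimit: "\<exists>L c. is_colimit J (AtoMon small) D L c"
  using ex_presented[OF small_letters] presented_colimit by metis

end

lemma (in small_universe) cocomplete_AtoMon: "cocomplete small (AtoMon small)"
  unfolding cocomplete_def
proof (intro allI impI)
  fix J :: "('u, 'u) cat" and D
  assume "small_cat small J" "is_functor J (AtoMon small) D"
  then interpret diagram small J D by unfold_locales
  show "\<exists>L c. is_colimit J (AtoMon small) D L c" by (rule ex_colimit)
qed

section \<open>Filtered colimits of atomic monoids\<close>

lemma colimit_factor:
  assumes "is_colimit J C D L c" "is_cocone J C D T t"
  shows "\<exists>!h. h \<in> Hom C L T \<and> (\<forall>j\<in>Obj J. cmp C (omap D j) L T h (c j) = t j)"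
  using assms unfolding is_colimit_def by blast

section \<open>Elements of a filtered colimit and when they are identified\<close>

locale filtered_diagram = diagram small J D for small :: "'u set \<Rightarrow> bool" and J D +
  assumes filtered_J: "filtered J"
begin

lemma ex_obj: "\<exists>i. i \<in> Obj J"
  using filtered_J unfolding filtered_def by blast

lemma ex_cospan:
  assumes "i \<in> Obj J" "j \<in> Obj J"
  obtains k f g where "k \<in> Obj J" "f \<in> Hom J i k" "g \<in> Hom J j k"
  using assms filtered_J unfolding filtered_def by blast

lemma ex_coequalize:
  assumes "i \<in> Obj J" "j \<in> Obj J" "f \<in> Hom J i j" "g \<in> Hom J i j"
  obtains k h where "k \<in> Obj J" "h \<in> Hom J j k" "cmp J i j k h f = cmp J i j k h g"
  using assms filtered_J unfolding filtered_def by blast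

text \<open>
  \<open>evaluates w k x\<close>: after transporting the letters of \<open>w\<close> to stage \<open>k\<close> along some arrows,
  their product is \<open>x\<close>. Having a common value at some stage is a congruence that contains the
  defining relations of the colimit.
\<close>

inductive evaluates :: "('u \<times> 'u) list \<Rightarrow> 'u \<Rightarrow> 'u \<Rightarrow> bool" where
  Nil: "k \<in> Obj J \<Longrightarrow> evaluates [] k \<one>\<^bsub>omap D k\<^esub>"
| Cons: "evaluates w k x \<Longrightarrow> j \<in> Obj J \<Longrightarrow> y \<in> carrier (omap D j) \<Longrightarrow> f \<in> Hom J j k \<Longrightarrow>
    evaluates ((j, y) # w) k (amap D j k f y \<otimes>\<^bsub>omap D k\<^esub> x)"

lemma evaluates_closed:
  "evaluates w k x \<Longrightarrow> k \<in> Obj J \<and> x \<in> carrier (omap D k)"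
proof (induction rule: evaluates.induct)
  case (Nil k)
  then show ?case using obj atomic_imp_monoid monoid.one_closed by blast
next
  case (Cons w k x j y f)
  then show ?case using obj atomic_imp_monoid monoid.m_closed arr_closed by metis
qed

lemma evaluates_push:
  assumes "evaluates w k x" "l \<in> Obj J" "h \<in> Hom J k l"
  shows "evaluates w l (amap D k l h x)"
  using assms(1,3)
proof (induction rule: evaluates.induct)
  case (Nil k)
  then show ?case using atom_hom_one[OF arr] assms(2) evaluates.Nil by metis
next
  case (Cons w k x j y f)
  note k = evaluates_closed[OF Cons.hyps(1)]
  have "amap D k l h (amap D j k f y \<otimes>\<^bsub>omap D k\<^esub> x)
      = amap D j l (cmp J j k l h f) y \<otimes>\<^bsub>omap D l\<^esub> amap D k l h x"
    using Cons k assms(2) arr_cmp[of j k l f h y]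
      atom_hom_mult[OF arr[of k l h], of "amap D j k f y" x] arr_closed[of j k f y] by simp
  moreover have "cmp J j k l h f \<in> Hom J j l" using cmp_J Cons k assms(2) by blast
  ultimately show ?case using Cons evaluates.Cons by metis
qed

lemma evaluates_append:
  assumes "evaluates v k x" "evaluates w k y"
  shows "evaluates (v @ w) k (x \<otimes>\<^bsub>omap D k\<^esub> y)"
proof -
  interpret atomic "omap D k" using obj assms evaluates_closed by blast
  have y: "y \<in> carrier (omap D k)" using assms(2) evaluates_closed by blast
  show ?thesis using assms
  proof (induction rule: evaluates.induct)
    case (Cons v k x j z f)
    interpret atomic "omap D k" using obj Cons evaluates_closed by blast
    have "amap D j k f z \<otimes>\<^bsub>omap D k\<^esub> x \<otimes>\<^bsub>omap D k\<^esub> y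
        = amap D j k f z \<otimes>\<^bsub>omap D k\<^esub> (x \<otimes>\<^bsub>omap D k\<^esub> y)"
      using Cons evaluates_closed arr_closed by (metis m_assoc)
    then show ?case using Cons evaluates.Cons by simp
  next
    case (Nil k)
    interpret atomic "omap D k" using obj Nil by blast
    show ?case using Nil evaluates_closed by simp
  qed
qed

lemma evaluates_singleton:
  assumes "k \<in> Obj J" "x \<in> carrier (omap D k)"
  shows "evaluates [(k, x)] k x"
proof -
  interpret atomic "omap D k" using obj assms by blast
  show ?thesis
    using evaluates.Cons[OF evaluates.Nil[of k] _ _ idt_J[of k], of x] assms by (simp add: arr_idt)
qed

lemma evaluates_singletonD:
  assumes "evaluates [(i, x)] k z"
  obtains f where "f \<in> Hom J i k" "z = amap D i k f x" "k \<in> Obj J"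
  using assms
proof cases
  case (Cons z' f)
  from Cons(2) have z': "z' = \<one>\<^bsub>omap D k\<^esub>" "k \<in> Obj J" by (auto elim: evaluates.cases)
  interpret atomic "omap D k" using obj z' by blast
  have "z = amap D i k f x" using Cons z' arr_closed by simp
  then show thesis using that Cons z' by blast
qed

text \<open>Two evaluations of a word may transport the same letter along different arrows. A cospan
  brings the two stages together, and for each further letter a coequalizing arrow makes the two
  transports agree.\<close>

lemma evaluates_confluent:
  assumes "evaluates w k x" "evaluates w k' x'"
  obtains l h h' where "l \<in> Obj J" "h \<in> Hom J k l" "h' \<in> Hom J k' l"
    "amap D k l h x = amap D k' l h' x'"
proof -
  have "\<exists>l h h'. l \<in> Obj J \<and> h \<in> Hom J k l \<and> h' \<in> Hom J k' l \<and>
      amap D k l h x = amap D k' l h' x'"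
    using assms
  proof (induction arbitrary: x' rule: evaluates.induct)
    case (Nil k)
    then have k': "k' \<in> Obj J" "x' = \<one>\<^bsub>omap D k'\<^esub>" by (auto elim: evaluates.cases)
    obtain l h h' where "l \<in> Obj J" "h \<in> Hom J k l" "h' \<in> Hom J k' l"
      using ex_cospan Nil.hyps k' by metis
    then show ?case using atom_hom_one[OF arr] k' Nil.hyps by metis
  next
    case (Cons w k x j y f)
    from Cons.prems obtain z f' where z: "evaluates w k' z" "f' \<in> Hom J j k'"
      "x' = amap D j k' f' y \<otimes>\<^bsub>omap D k'\<^esub> z"
      by (auto elim: evaluates.cases)
    from Cons.IH[OF z(1)] obtain l h h' where l: "l \<in> Obj J" "h \<in> Hom J k l" "h' \<in> Hom J k' l"
      "amap D k l h x = amap D k' l h' z" by blast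
    have k: "k \<in> Obj J" "x \<in> carrier (omap D k)" and k': "k' \<in> Obj J" "z \<in> carrier (omap D k')"
      using evaluates_closed Cons.hyps(1) z(1) by blast+
    have hf: "cmp J j k l h f \<in> Hom J j l" "cmp J j k' l h' f' \<in> Hom J j l"
      using cmp_J Cons.hyps k k' l z by blast+
    \<comment> \<open>Both composites run from the stage \<open>j\<close> of the new letter to
      \<open>l\<close>; moving on to \<open>m\<close> makes them equal without disturbing the
      agreement already reached for the rest of the word.\<close>
    then obtain m e where m: "m \<in> Obj J" "e \<in> Hom J l m"
      "cmp J j l m e (cmp J j k l h f) = cmp J j l m e (cmp J j k' l h' f')"
      using ex_coequalize[OF Cons.hyps(2) l(1)] by metis
    have "amap D j l (cmp J j k l h f) y = amap D k l h (amap D j k f y)"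
      "amap D j l (cmp J j k' l h' f') y = amap D k' l h' (amap D j k' f' y)"
      using arr_cmp Cons.hyps k k' l z by blast+
    then have e: "amap D l m e (amap D k l h (amap D j k f y))
        = amap D l m e (amap D k' l h' (amap D j k' f' y))"
      using arr_cmp[OF Cons.hyps(2) l(1) m(1) hf(1) m(2) Cons.hyps(3)]
        arr_cmp[OF Cons.hyps(2) l(1) m(1) hf(2) m(2) Cons.hyps(3)] m(3) by simp
    \<comment> \<open>The same computation is needed for both evaluations, with \<open>a\<close>
      standing for \<open>k\<close> and for \<open>k'\<close>.\<close>
    have *: "amap D a m (cmp J a l m e g) (amap D j a t y \<otimes>\<^bsub>omap D a\<^esub> u)
        = amap D l m e (amap D a l g (amap D j a t y)) \<otimes>\<^bsub>omap D m\<^esub> amap D l m e (amap D a l g u)"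
      if "a \<in> Obj J" "g \<in> Hom J a l" "t \<in> Hom J j a" "u \<in> carrier (omap D a)" for a g t u
    proof -
      interpret atomic "omap D a" using obj that by blast
      have y: "amap D j a t y \<in> carrier (omap D a)" using arr_closed Cons.hyps that by blast
      then have "amap D a m (cmp J a l m e g) (amap D j a t y \<otimes>\<^bsub>omap D a\<^esub> u)
          = amap D l m e (amap D a l g (amap D j a t y \<otimes>\<^bsub>omap D a\<^esub> u))"
        using that arr_cmp[OF that(1) l(1) m(1) that(2) m(2)] by simp
      also have "\<dots> = amap D l m e (amap D a l g (amap D j a t y) \<otimes>\<^bsub>omap D l\<^esub> amap D a l g u)"
        using that y l atom_hom_mult[OF arr] by simp
      also have "\<dots> = amap D l m e (amap D a l g (amap D j a t y)) \<otimes>\<^bsub>omap D m\<^esub>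
          amap D l m e (amap D a l g u)"
        using that y l m by (intro atom_hom_mult[OF arr] arr_closed[of a l g])
      finally show ?thesis .
    qed
    have "amap D k m (cmp J k l m e h) (amap D j k f y \<otimes>\<^bsub>omap D k\<^esub> x)
        = amap D k' m (cmp J k' l m e h') x'"
      unfolding z(3) *[OF k(1) l(2) Cons.hyps(4) k(2)] *[OF k'(1) l(3) z(2) k'(2)] e l(4) ..
    moreover have "cmp J k l m e h \<in> Hom J k m" "cmp J k' l m e h' \<in> Hom J k' m"
      using cmp_J k k' l m by blast+
    ultimately show ?case using m(1) by blast
  qed
  then show thesis using that by blast
qed

lemma evaluates_push2:
  assumes "evaluates u k x" "evaluates v k' y"
  obtains l h h' where "l \<in> Obj J" "h \<in> Hom J k l" "h' \<in> Hom J k' l"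
    "evaluates u l (amap D k l h x)" "evaluates v l (amap D k' l h' y)"
  using assms ex_cospan evaluates_push evaluates_closed by metis

lemma ex_evaluates: "w \<in> lists letters \<Longrightarrow> \<exists>k x. evaluates w k x"
proof (induction w rule: list.induct)
  case Nil
  then show ?case using ex_obj evaluates.Nil by blast
next
  case (Cons a w)
  then obtain k x where kx: "evaluates w k x" by auto
  obtain j y where jy: "a = (j, y)" "j \<in> Obj J" "y \<in> carrier (omap D j)"
    using Cons.prems by (cases a) auto
  from evaluates_push2[OF evaluates_singleton[OF jy(2,3)] kx]
  show ?case using evaluates_append[of "[a]" _ _ w] jy(1) by (metis append_Cons append_Nil)
qed

text \<open>Transitivity is the critical case: the middle word has two values at two stages, which
  \<open>evaluates_confluent\<close> reconciles.\<close>

lemma pcong_imp_evaluates: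
  "pcong letters rels v w \<Longrightarrow> \<exists>k x. evaluates v k x \<and> evaluates w k x"
proof (induction rule: pcong.induct)
  case (refl w)
  then show ?case using ex_evaluates by blast
next
  case (rel v w)
  from rel(1) show ?case
  proof cases
    case (mult j x y)
    have "evaluates ([(j, x)] @ [(j, y)]) j (x \<otimes>\<^bsub>omap D j\<^esub> y)"
      using evaluates_append evaluates_singleton mult by blast
    moreover have "evaluates w j (x \<otimes>\<^bsub>omap D j\<^esub> y)"
      using mult rel(3) evaluates_singleton by simp
    ultimately show ?thesis using mult(1) by auto
  next
    case (one j)
    then have "evaluates v j \<one>\<^bsub>omap D j\<^esub>" "evaluates w j \<one>\<^bsub>omap D j\<^esub>"
      using rel(2) evaluates_singleton evaluates.Nil by auto
    then show ?thesis by blast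
  next
    case (arrow i j f x)
    have "evaluates [(i, x)] j (amap D i j f x)"
      using evaluates_push evaluates_singleton arrow by blast
    moreover have "evaluates w j (amap D i j f x)"
      using arrow evaluates_singleton arr_closed by blast
    ultimately show ?thesis using arrow(1) by blast
  qed
next
  case (trans u v w)
  then obtain k x k' x' where 1: "evaluates u k x" "evaluates v k x"
    "evaluates v k' x'" "evaluates w k' x'" by blast
  then obtain l h h' where "l \<in> Obj J" "h \<in> Hom J k l" "h' \<in> Hom J k' l"
    "amap D k l h x = amap D k' l h' x'" using evaluates_confluent by metis
  then show ?case using evaluates_push 1 by metis
next
  case (append v v' w w')
  then obtain k x k' y where 1: "evaluates v k x" "evaluates v' k x"
    "evaluates w k' y" "evaluates w' k' y" by blast
  obtain l h h' where "l \<in> Obj J" "h \<in> Hom J k l" "h' \<in> Hom J k' l"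
    using ex_cospan evaluates_closed 1 by metis
  then have "evaluates v l (amap D k l h x)" "evaluates v' l (amap D k l h x)"
    "evaluates w l (amap D k' l h' y)" "evaluates w' l (amap D k' l h' y)"
    using evaluates_push 1 by blast+
  then show ?case using evaluates_append by blast
qed blast

lemma evaluates_imp_pcong:
  "evaluates w k x \<Longrightarrow> pcong letters rels w [(k, x)]"
proof (induction rule: evaluates.induct)
  case (Nil k)
  then show ?case using one_pcong pcong.sym by blast
next
  case (Cons w k x j y f)
  have k: "k \<in> Obj J" "x \<in> carrier (omap D k)" using Cons.hyps evaluates_closed by blast+
  have "pcong letters rels ([(j, y)] @ w) ([(k, amap D j k f y)] @ [(k, x)])"
    using arrow_pcong Cons k by (intro pcong.append) auto
  moreover have "pcong letters rels [(k, amap D j k f y), (k, x)]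
      [(k, amap D j k f y \<otimes>\<^bsub>omap D k\<^esub> x)]"
    using mult_pcong arr_closed Cons k by blast
  ultimately show ?case by (auto intro: pcong.trans)
qed

text \<open>The colimit \<open>L\<close> is arbitrary, while words describe only the presented one.
  The mediating maps \<open>h\<close> and \<open>h'\<close> transfer the description:
  \<open>h\<close> turns equality in \<open>L\<close> into congruence of words, and
  \<open>h'\<close> brings elements written as words back to \<open>L\<close>.\<close>

lemma
  assumes colim: "is_colimit J (AtoMon small) D L c"
  shows colimit_surj: "x \<in> carrier L \<Longrightarrow> \<exists>j\<in>Obj J. \<exists>y\<in>carrier (omap D j). x = c j y"
    and colimit_inj: "i \<in> Obj J \<Longrightarrow> x \<in> carrier (omap D i) \<Longrightarrow> y \<in> carrier (omap D i) \<Longrightarrow>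
      c i x = c i y \<Longrightarrow> \<exists>k\<in>Obj J. \<exists>f\<in>Hom J i k. amap D i k f x = amap D i k f y"
proof -
  obtain q M where pres: "presented letters rels q M" and "small (carrier M)"
    using ex_presented[OF small_letters] by metis
  then have colim': "is_colimit J (AtoMon small) D M (coproj q)" by (rule presented_colimit)
  interpret presented letters rels q M by (rule pres)
  have cocone: "is_cocone J (AtoMon small) D L c" "is_cocone J (AtoMon small) D M (coproj q)"
    using colim colim' unfolding is_colimit_def by blast+
  obtain h where h: "h \<in> atom_hom L M"
    "\<And>j. j \<in> Obj J \<Longrightarrow> compose (carrier (omap D j)) h (c j) = coproj q j"
    using ex1_implies_ex[OF colimit_factor[OF colim cocone(2)]] unfolding AtoMon_simps by blast
  obtain h' where h': "h' \<in> atom_hom M L"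
    "\<And>j. j \<in> Obj J \<Longrightarrow> compose (carrier (omap D j)) h' (coproj q j) = c j"
    using ex1_implies_ex[OF colimit_factor[OF colim' cocone(1)]] unfolding AtoMon_simps by blast
  have c: "c j \<in> atom_hom (omap D j) L" if "j \<in> Obj J" for j
    using cocone(1) that by (simp add: is_cocone_def)
  have hc: "h (c j x) = q [(j, x)]" "h' (q [(j, x)]) = c j x"
    if "j \<in> Obj J" "x \<in> carrier (omap D j)" for j x
    using fun_cong[OF h(2)[OF that(1)], of x] fun_cong[OF h'(2)[OF that(1)], of x] that
    by (simp_all add: compose_def coproj_def)
  have L: "atomic L" using cocone(1) by (simp add: is_cocone_def)
  \<comment> \<open>Both maps mediate from the colimit cocone to itself, so uniqueness identifies
    them.\<close>
  have id: "compose (carrier L) h' h = (\<lambda>x\<in>carrier L. x)"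
  proof -
    have "\<exists>!k. k \<in> atom_hom L L \<and> (\<forall>j\<in>Obj J. compose (carrier (omap D j)) k (c j) = c j)"
      using colimit_factor[OF colim cocone(1)] unfolding AtoMon_simps .
    moreover have "compose (carrier L) h' h \<in> atom_hom L L"
      using atom_hom_compose atomic_imp_monoid L h h' by blast
    moreover have "(\<lambda>x\<in>carrier L. x) \<in> atom_hom L L"
      using atom_hom_id atomic_imp_monoid L by blast
    moreover have "compose (carrier (omap D j)) (compose (carrier L) h' h) (c j) = c j"
      "compose (carrier (omap D j)) (\<lambda>x\<in>carrier L. x) (c j) = c j" if j: "j \<in> Obj J" for j
    proof -
      have "c j \<in> extensional (carrier (omap D j))" using c[OF j] by (simp add: atom_hom_def)
      then show "compose (carrier (omap D j)) (compose (carrier L) h' h) (c j) = c j"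
        "compose (carrier (omap D j)) (\<lambda>x\<in>carrier L. x) (c j) = c j"
        using hc j atom_hom_carrier[OF c[OF j]]
        by (auto simp: compose_def fun_eq_iff extensional_def)
    qed
    ultimately show ?thesis by blast
  qed
  have hh: "h' (h x) = x" if "x \<in> carrier L" for x
    using fun_cong[OF id, of x] that by (simp add: compose_def)
  {
    assume x: "x \<in> carrier L"
    then obtain w where w: "w \<in> lists letters" "h x = q w"
      using atom_hom_carrier[OF h(1)] carrierE by metis
    then obtain k z where kz: "evaluates w k z" using ex_evaluates by blast
    then have "pcong letters rels w [(k, z)]" by (rule evaluates_imp_pcong)
    then have "q w = q [(k, z)]" using q_eq_iff pcong_lists by blast
    then have "x = c k z" using hc hh[OF x] w evaluates_closed[OF kz] by simp
    then show "\<exists>j\<in>Obj J. \<exists>y\<in>carrier (omap D j). x = c j y" using evaluates_closed[OF kz] by blast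
  }
  {
    assume i: "i \<in> Obj J" "x \<in> carrier (omap D i)" "y \<in> carrier (omap D i)" and "c i x = c i y"
    then have "q [(i, x)] = q [(i, y)]" using hc by metis
    then have "pcong letters rels [(i, x)] [(i, y)]"
      using q_eq_iff[of "[(i, x)]" "[(i, y)]"] i by simp
    then obtain k z where "evaluates [(i, x)] k z" "evaluates [(i, y)] k z"
      using pcong_imp_evaluates by blast
    then obtain f g where fg: "f \<in> Hom J i k" "g \<in> Hom J i k" "k \<in> Obj J"
      "amap D i k f x = amap D i k g y"
      using evaluates_singletonD by metis
    \<comment> \<open>The two letters were transported along possibly different arrows
      \<open>f\<close> and \<open>g\<close>, whereas the claim asks for a single arrow.\<close>
    then obtain l e where l: "l \<in> Obj J" "e \<in> Hom J k l" "cmp J i k l e f = cmp J i k l e g"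
      using ex_coequalize i by metis
    then have "amap D i l (cmp J i k l e f) x = amap D i l (cmp J i k l e f) y"
      using arr_cmp i fg by metis
    then show "\<exists>k\<in>Obj J. \<exists>f\<in>Hom J i k. amap D i k f x = amap D i k f y"
      using l cmp_J i fg by blast
  }
qed

end

section \<open>Compactness of finitely presented objects\<close>

lemma SetCat_simps [simp]:
  "Obj SetCat = UNIV"
  "Hom SetCat A B = (A \<rightarrow>\<^sub>E B)"
  "cmp SetCat A B E g f = compose A g f"
  by (simp_all add: SetCat_def)

text \<open>Joint surjectivity defines the mediating map. For well-definedness, elements of
  different stages are moved to a common stage by a cospan, where \<open>inj\<close> makes them
  equal later on, and cocones do not see such moves.\<close>

lemma SetCat_filtered_colimitI:
  assumes "filtered J" and cocone: "is_cocone J SetCat E S s"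
    and arr: "\<And>i j f. i \<in> Obj J \<Longrightarrow> j \<in> Obj J \<Longrightarrow> f \<in> Hom J i j \<Longrightarrow>
      amap E i j f \<in> omap E i \<rightarrow> omap E j"
    and surj: "\<And>x. x \<in> S \<Longrightarrow> \<exists>j\<in>Obj J. \<exists>y\<in>omap E j. x = s j y"
    and inj: "\<And>i x y. i \<in> Obj J \<Longrightarrow> x \<in> omap E i \<Longrightarrow> y \<in> omap E i \<Longrightarrow> s i x = s i y \<Longrightarrow>
      \<exists>k\<in>Obj J. \<exists>f\<in>Hom J i k. amap E i k f x = amap E i k f y"
  shows "is_colimit J SetCat E S s"
  unfolding is_colimit_def
proof (intro conjI allI impI)
  fix T t assume cocone': "is_cocone J SetCat E T t"
  have push: "u j (amap E i j f x) = u i x"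
    if "is_cocone J SetCat E U u" "i \<in> Obj J" "j \<in> Obj J" "f \<in> Hom J i j" "x \<in> omap E i"
    for U u i j f x
  proof -
    have "compose (omap E i) (u j) (amap E i j f) = u i"
      using that unfolding is_cocone_def by simp
    then show ?thesis using that(5) by (metis compose_eq)
  qed
  have s: "s j \<in> omap E j \<rightarrow>\<^sub>E S" and t: "t j \<in> omap E j \<rightarrow>\<^sub>E T" if "j \<in> Obj J" for j
    using cocone cocone' that unfolding is_cocone_def by simp_all
  have welldef: "t i x = t j y"
    if i: "i \<in> Obj J" "x \<in> omap E i" and j: "j \<in> Obj J" "y \<in> omap E j" and eq: "s i x = s j y"
    for i x j y
  proof -
    obtain k f g where k: "k \<in> Obj J" "f \<in> Hom J i k" "g \<in> Hom J j k"
      using assms(1) i j unfolding filtered_def by blast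
    then have cl: "amap E i k f x \<in> omap E k" "amap E j k g y \<in> omap E k"
      using arr i j by blast+
    have "s k (amap E i k f x) = s k (amap E j k g y)" using push[OF cocone] i j k eq by simp
    then obtain l e where l: "l \<in> Obj J" "e \<in> Hom J k l"
      "amap E k l e (amap E i k f x) = amap E k l e (amap E j k g y)"
      using inj[OF k(1) cl] by blast
    then have "t k (amap E i k f x) = t k (amap E j k g y)"
      using push[OF cocone' k(1) l(1,2)] cl by metis
    then show ?thesis using push[OF cocone'] i j k by simp
  qed
  define h where "h = (\<lambda>x\<in>S. SOME z. \<exists>j\<in>Obj J. \<exists>y\<in>omap E j. x = s j y \<and> z = t j y)"
  have h: "h (s j y) = t j y" if "j \<in> Obj J" "y \<in> omap E j" for j y
  proof -
    have "s j y \<in> S" using s that by blast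
    moreover have "(SOME z. \<exists>j'\<in>Obj J. \<exists>y'\<in>omap E j'. s j y = s j' y' \<and> z = t j' y') = t j y"
      by (rule some_equality) (use that welldef in metis)+
    ultimately show ?thesis by (simp add: h_def)
  qed
  show "\<exists>!h. h \<in> Hom SetCat S T \<and> (\<forall>j\<in>Obj J. cmp SetCat (omap E j) S T h (s j) = t j)"
  proof (rule ex1I[of _ h])
    have "h x \<in> T" if "x \<in> S" for x using surj[OF that] h t by fastforce
    then have "h \<in> S \<rightarrow>\<^sub>E T" by (auto simp: h_def)
    moreover have "compose (omap E j) h (s j) = t j" if "j \<in> Obj J" for j
      using h that t[OF that] by (auto simp: compose_def fun_eq_iff PiE_def extensional_def)
    ultimately show "h \<in> Hom SetCat S T \<and> (\<forall>j\<in>Obj J. cmp SetCat (omap E j) S T h (s j) = t j)"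
      by simp
    fix k assume k: "k \<in> Hom SetCat S T \<and> (\<forall>j\<in>Obj J. cmp SetCat (omap E j) S T k (s j) = t j)"
    show "k = h"
    proof (rule extensionalityI[of _ S])
      show "k \<in> extensional S" "h \<in> extensional S" using k by (auto simp: h_def PiE_def)
      fix x assume "x \<in> S"
      then obtain j y where j: "j \<in> Obj J" "y \<in> omap E j" "x = s j y" using surj by blast
      then have "compose (omap E j) k (s j) y = t j y" using k by simp
      then show "k x = h x" using j h by (simp add: compose_def)
    qed
  qed
qed (rule cocone)

section \<open>Bringing finite data of a filtered colimit to a single stage\<close>

locale filtered_colimit = filtered_diagram small J D
  for small :: "'u set \<Rightarrow> bool" and J D +
  fixes L :: "'u monoid" and c
  assumes colim: "is_colimit J (AtoMon small) D L c"
begin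

lemma cocone: "is_cocone J (AtoMon small) D L c"
  using colim by (simp add: is_colimit_def)

lemma apex: "atomic L"
  using cocone by (simp add: is_cocone_def)

lemma leg: "j \<in> Obj J \<Longrightarrow> c j \<in> atom_hom (omap D j) L"
  using cocone by (simp add: is_cocone_def)

lemma leg_arr:
  assumes "i \<in> Obj J" "j \<in> Obj J" "f \<in> Hom J i j" "x \<in> carrier (omap D i)"
  shows "c j (amap D i j f x) = c i x"
proof -
  have "compose (carrier (omap D i)) (c j) (amap D i j f) = c i"
    using cocone assms by (simp add: is_cocone_def)
  then show ?thesis using assms(4) by (metis compose_eq)
qed

lemma finite_lift:
  assumes "finite A" "\<And>a. a \<in> A \<Longrightarrow> \<xi> a \<in> carrier L"
  shows "\<exists>j\<in>Obj J. \<exists>\<eta>. \<forall>a\<in>A. \<eta> a \<in> carrier (omap D j) \<and> c j (\<eta> a) = \<xi> a"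
  using assms
proof (induction A rule: finite_induct)
  case empty
  then show ?case using ex_obj by blast
next
  case (insert b A)
  then obtain j \<eta> where j: "j \<in> Obj J" "\<forall>a\<in>A. \<eta> a \<in> carrier (omap D j) \<and> c j (\<eta> a) = \<xi> a"
    by blast
  have "\<xi> b \<in> carrier L" using insert.prems by blast
  then obtain i y where i: "i \<in> Obj J" "y \<in> carrier (omap D i)" "\<xi> b = c i y"
    using colimit_surj[OF colim] by blast
  obtain k f g where k: "k \<in> Obj J" "f \<in> Hom J j k" "g \<in> Hom J i k" using ex_cospan i j by metis
  have "\<forall>a\<in>insert b A. ((\<lambda>a. amap D j k f (\<eta> a))(b := amap D i k g y)) a \<in> carrier (omap D k) \<and>
      c k (((\<lambda>a. amap D j k f (\<eta> a))(b := amap D i k g y)) a) = \<xi> a"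
    using i j k leg_arr arr_closed by auto
  then show ?case using k(1) by blast
qed

text \<open>Pairs are merged one at a time. Identifications made earlier survive, since every new
  arrow is composed after the previous one.\<close>

lemma finite_identify:
  assumes "finite P" "i \<in> Obj J"
    "\<And>x y. (x, y) \<in> P \<Longrightarrow> x \<in> carrier (omap D i) \<and> y \<in> carrier (omap D i) \<and> c i x = c i y"
  shows "\<exists>k\<in>Obj J. \<exists>f\<in>Hom J i k. \<forall>(x, y)\<in>P. amap D i k f x = amap D i k f y"
  using assms(1,3)
proof (induction P rule: finite_induct)
  case empty
  then show ?case using assms(2) idt_J by auto
next
  case (insert p P)
  obtain x y where p: "p = (x, y)" by fastforce
  from insert obtain k f where k: "k \<in> Obj J" "f \<in> Hom J i k"
    "\<forall>(x, y)\<in>P. amap D i k f x = amap D i k f y" by blast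
  have xy: "x \<in> carrier (omap D i)" "y \<in> carrier (omap D i)" "c i x = c i y"
    using insert.prems p by blast+
  then have "c k (amap D i k f x) = c k (amap D i k f y)" using leg_arr k assms(2) by simp
  then obtain l e where l: "l \<in> Obj J" "e \<in> Hom J k l"
    "amap D k l e (amap D i k f x) = amap D k l e (amap D i k f y)"
    using colimit_inj[OF colim k(1)] arr_closed[OF assms(2) k(1,2)] xy by metis
  have "amap D i l (cmp J i k l e f) u = amap D i l (cmp J i k l e f) v" if "(u, v) \<in> insert p P" for u v
  proof -
    have "u \<in> carrier (omap D i)" "v \<in> carrier (omap D i)" using insert.prems[OF that] by blast+
    moreover have "amap D k l e (amap D i k f u) = amap D k l e (amap D i k f v)"
      using that k(3) l(3) p by auto
    ultimately show ?thesis using arr_cmp[OF assms(2) k(1) l(1) k(2) l(2)] by simp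
  qed
  moreover have "cmp J i k l e f \<in> Hom J i l" using cmp_J assms(2) k l by blast
  ultimately show ?case using l(1) by blast
qed

end

text \<open>A homomorphism from \<open>M\<close> amounts to values for finitely many letters subject
  to finitely many relations, so both its existence and its equality with another one are settled at
  some stage. The bound on \<open>g\<close> makes it agree with the degree in \<open>M\<close>,
  which is truncated at 2.\<close>

lemma (in small_universe) compact_presented:
  assumes "graded_presented G R q M g" "finite G" "finite R" "\<And>a. a \<in> G \<Longrightarrow> g a \<le> 2"
    "small (carrier M)"
  shows "compact_object small (AtoMon small) M"
  unfolding compact_object_def preserves_filtered_colimits_def
proof (intro conjI allI impI)
  interpret graded_presented G R q M g by fact
  show "M \<in> Obj (AtoMon small)" using atomic assms(5) by simp
  fix J :: "('u, 'u) cat" and D L c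
  assume *: "small_cat small J" "filtered J" "is_functor J (AtoMon small) D"
    "is_colimit J (AtoMon small) D L c"
  then interpret filtered_colimit small J D L c
    by unfold_locales
  let ?F = "hom_functor (AtoMon small) M"
  let ?E = "comp_functor ?F D"
  let ?s = "\<lambda>j. amap ?F (omap D j) L (c j)"
  have E [simp]: "omap ?E j = atom_hom M (omap D j)"
      "amap ?E i j f = (\<lambda>\<phi>\<in>atom_hom M (omap D i). compose (carrier M) (amap D i j f) \<phi>)"
      "omap ?F L = atom_hom M L"
      "?s j = (\<lambda>\<phi>\<in>atom_hom M (omap D j). compose (carrier M) (c j) \<phi>)" for i j f
    by (simp_all add: comp_functor_def hom_functor_def)
  show "is_colimit J SetCat ?E (omap ?F L) ?s"
  proof (rule SetCat_filtered_colimitI[OF *(2)])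
    show "is_cocone J SetCat ?E (omap ?F L) ?s"
      unfolding is_cocone_def
    proof (intro conjI ballI)
      fix j assume "j \<in> Obj J"
      then show "?s j \<in> Hom SetCat (omap ?E j) (omap ?F L)"
        using atom_hom_compose[OF monoid _ leg] by auto
    next
      fix i j f assume ij: "i \<in> Obj J" "j \<in> Obj J" "f \<in> Hom J i j"
      have "compose (carrier M) (c j) (compose (carrier M) (amap D i j f) \<phi>)
          = compose (carrier M) (c i) \<phi>" if "\<phi> \<in> atom_hom M (omap D i)" for \<phi>
        using atom_hom_carrier[OF that] leg_arr[OF ij] by (auto simp: compose_def fun_eq_iff)
      then show "cmp SetCat (omap ?E i) (omap ?E j) (omap ?F L) (?s j) (amap ?E i j f) = ?s i"
        using atom_hom_compose[OF monoid _ arr[OF ij]]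
        by (auto simp: compose_def[of "atom_hom _ _"] fun_eq_iff)
    qed simp
  next
    fix i j f assume "i \<in> Obj J" "j \<in> Obj J" "f \<in> Hom J i j"
    then show "amap ?E i j f \<in> omap ?E i \<rightarrow> omap ?E j"
      using atom_hom_compose[OF monoid _ arr] by auto
  next
    fix \<psi> assume "\<psi> \<in> omap ?F L"
    then have \<psi>: "\<psi> \<in> atom_hom M L" by simp
    have qa: "q [a] \<in> carrier M" if "a \<in> G" for a using that q_carrier by simp
    then obtain j \<eta> where j: "j \<in> Obj J"
      and \<eta>: "\<And>a. a \<in> G \<Longrightarrow> \<eta> a \<in> carrier (omap D j) \<and> c j (\<eta> a) = \<psi> (q [a])"
      using finite_lift[OF assms(2), of "\<lambda>a. \<psi> (q [a])"] atom_hom_carrier[OF \<psi>] by metis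
    interpret Dj: atomic "omap D j" using obj j by blast
    have \<eta>_lists: "set (map \<eta> w) \<subseteq> carrier (omap D j)" if "w \<in> lists G" for w using \<eta> that by auto
    have c_mprod: "c j (mprod (omap D j) (map \<eta> w)) = \<psi> (q w)" if w: "w \<in> lists G" for w
    proof -
      have "c j (mprod (omap D j) (map \<eta> w)) = mprod L (map (c j) (map \<eta> w))"
        using atom_hom_mprod[OF Dj.monoid_axioms leg[OF j] \<eta>_lists[OF w]] .
      also have "map (c j) (map \<eta> w) = map (\<lambda>a. \<psi> (q [a])) w" using w \<eta> by auto
      also have "mprod L \<dots> = \<psi> (q w)" using hom_q[OF \<psi> w] by simp
      finally show ?thesis .
    qed
    \<comment> \<open>The relations hold for the lifted letters only after \<open>c j\<close>. The
      pairs in \<open>P\<close> are the equations that a later stage has to satisfy; only words over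
      \<open>G\<close> count, since \<open>\<eta>\<close> is controlled only there.\<close>
    define P where "P = map_prod (\<lambda>w. mprod (omap D j) (map \<eta> w)) (\<lambda>w. mprod (omap D j) (map \<eta> w)) `
      (R \<inter> lists G \<times> lists G)"
    have "finite P" using assms(3) by (simp add: P_def)
    moreover have "x \<in> carrier (omap D j) \<and> y \<in> carrier (omap D j) \<and> c j x = c j y"
      if "(x, y) \<in> P" for x y
    proof -
      from that obtain v w where vw: "(v, w) \<in> R" "v \<in> lists G" "w \<in> lists G"
        "x = mprod (omap D j) (map \<eta> v)" "y = mprod (omap D j) (map \<eta> w)"
        by (auto simp: P_def)
      then have "q v = q w" using q_eq_iff pcong.rel by metis
      then show ?thesis using vw c_mprod \<eta>_lists Dj.mprod_closed by metis
    qed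
    ultimately obtain k f where k: "k \<in> Obj J" "f \<in> Hom J j k"
      and P: "\<forall>(x, y)\<in>P. amap D j k f x = amap D j k f y"
      using finite_identify[OF _ j] by metis
    obtain \<phi> where \<phi>: "\<phi> \<in> atom_hom M (omap D k)"
      "\<And>w. w \<in> lists G \<Longrightarrow> \<phi> (q w) = mprod (omap D k) (map (\<lambda>a. amap D j k f (\<eta> a)) w)"
    proof (rule lift[of "omap D k" "\<lambda>a. amap D j k f (\<eta> a)"])
      show "atomic (omap D k)" using obj k by blast
      show "amap D j k f (\<eta> a) \<in> carrier (omap D k)" if "a \<in> G" for a
        using that \<eta> arr_closed j k by blast
      \<comment> \<open>The degree is forced, because the arrow, the leg and \<open>\<psi>\<close>
        all preserve it.\<close>
      show "grade (omap D k) (amap D j k f (\<eta> a)) = g a" if a: "a \<in> G" for a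
      proof -
        have "grade (omap D k) (amap D j k f (\<eta> a)) = grade (omap D j) (\<eta> a)"
          using atom_hom_grade[OF obj(1) obj(1) arr] j k \<eta> a by blast
        also have "\<dots> = grade L (c j (\<eta> a))"
          using atom_hom_grade[OF obj(1)[OF j] apex leg[OF j]] \<eta>[OF a] by metis
        also have "\<dots> = grade M (q [a])"
          using atom_hom_grade[OF atomic apex \<psi>] \<eta> a qa by simp
        also have "\<dots> = g a" using grade_q[of "[a]"] a assms(4)[OF a] by (simp add: wgrade_def)
        finally show ?thesis .
      qed
      fix v w assume vw: "(v, w) \<in> R" "v \<in> lists G" "w \<in> lists G"
      then have "(mprod (omap D j) (map \<eta> v), mprod (omap D j) (map \<eta> w)) \<in> P"
        unfolding P_def by force
      then have "amap D j k f (mprod (omap D j) (map \<eta> v)) = amap D j k f (mprod (omap D j) (map \<eta> w))"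
        using P by blast
      then show "mprod (omap D k) (map (\<lambda>a. amap D j k f (\<eta> a)) v) =
          mprod (omap D k) (map (\<lambda>a. amap D j k f (\<eta> a)) w)"
        using atom_hom_mprod[OF Dj.monoid_axioms arr[OF j k] \<eta>_lists] vw by (simp add: comp_def)
    qed (rule that)
    interpret Dk: atomic "omap D k" using obj k by blast
    have "compose (carrier M) (c k) \<phi> = \<psi>"
    proof (rule hom_eqI)
      show "compose (carrier M) (c k) \<phi> \<in> atom_hom M L"
        using atom_hom_compose[OF monoid \<phi>(1) leg] k by blast
      show "\<psi> \<in> atom_hom M L" by (rule \<psi>)
      fix a assume a: "a \<in> G"
      then have "\<phi> (q [a]) = amap D j k f (\<eta> a)"
        using \<phi>(2)[of "[a]"] arr_closed[OF j k] \<eta> by simp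
      then show "compose (carrier M) (c k) \<phi> (q [a]) = \<psi> (q [a])"
        using qa[OF a] leg_arr[OF j k] \<eta>[OF a] by (simp add: compose_def)
    qed
    then show "\<exists>j\<in>Obj J. \<exists>\<phi>\<in>omap ?E j. \<psi> = ?s j \<phi>"
      using k(1) \<phi>(1) by (intro bexI[of _ k] bexI[of _ \<phi>]) simp_all
  next
    fix i \<phi> \<phi>' assume i: "i \<in> Obj J" and "\<phi> \<in> omap ?E i" "\<phi>' \<in> omap ?E i" and "?s i \<phi> = ?s i \<phi>'"
    then have \<phi>: "\<phi> \<in> atom_hom M (omap D i)" "\<phi>' \<in> atom_hom M (omap D i)"
      and eq: "compose (carrier M) (c i) \<phi> = compose (carrier M) (c i) \<phi>'"
      by simp_all
    have qa: "q [a] \<in> carrier M" if "a \<in> G" for a using that q_carrier by simp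
    \<comment> \<open>Merging the values on the letters suffices, since these determine a
      homomorphism from \<open>M\<close>.\<close>
    define P where "P = (\<lambda>a. (\<phi> (q [a]), \<phi>' (q [a]))) ` G"
    have "finite P" using assms(2) by (simp add: P_def)
    moreover have "x \<in> carrier (omap D i) \<and> y \<in> carrier (omap D i) \<and> c i x = c i y"
      if xy: "(x, y) \<in> P" for x y
    proof -
      from xy obtain a where a: "a \<in> G" "x = \<phi> (q [a])" "y = \<phi>' (q [a])" by (auto simp: P_def)
      then show ?thesis
        using fun_cong[OF eq, of "q [a]"] qa[OF a(1)] atom_hom_carrier[OF \<phi>(1)]
          atom_hom_carrier[OF \<phi>(2)] by (simp add: compose_def)
    qed
    ultimately obtain k f where k: "k \<in> Obj J" "f \<in> Hom J i k"
      and P: "\<forall>(x, y)\<in>P. amap D i k f x = amap D i k f y"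
      using finite_identify[OF _ i] by metis
    have "compose (carrier M) (amap D i k f) \<phi> = compose (carrier M) (amap D i k f) \<phi>'"
    proof (rule hom_eqI)
      show "compose (carrier M) (amap D i k f) \<phi> \<in> atom_hom M (omap D k)"
        "compose (carrier M) (amap D i k f) \<phi>' \<in> atom_hom M (omap D k)"
        using atom_hom_compose[OF monoid _ arr[OF i k]] \<phi> by blast+
      fix a assume "a \<in> G"
      then show "compose (carrier M) (amap D i k f) \<phi> (q [a]) = compose (carrier M) (amap D i k f) \<phi>' (q [a])"
        using P qa by (auto simp: P_def compose_def)
    qed
    then show "\<exists>k\<in>Obj J. \<exists>f\<in>Hom J i k. amap ?E i k f \<phi> = amap ?E i k f \<phi>'"
      using k \<phi> by (intro bexI[of _ k] bexI[of _ f]) simp_all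
  qed
qed

section \<open>Finitely presented objects\<close>

text \<open>Relabelling by the inverse of \<open>\<phi>\<close> on \<open>G\<close> carries the
  congruence back. It restores \<open>R\<close> exactly, because all letters of \<open>R\<close> lie
  in \<open>G\<close>.\<close>

lemma pcong_map_iff:
  assumes "inj_on \<phi> G" "R \<subseteq> lists G \<times> lists G" "v \<in> lists G" "w \<in> lists G"
  shows "pcong (\<phi> ` G) (map_prod (map \<phi>) (map \<phi>) ` R) (map \<phi> v) (map \<phi> w) \<longleftrightarrow> pcong G R v w"
proof
  assume *: "pcong (\<phi> ` G) (map_prod (map \<phi>) (map \<phi>) ` R) (map \<phi> v) (map \<phi> w)"
  define \<psi> where "\<psi> = inv_into G \<phi>"
  have inv: "map \<psi> (map \<phi> u) = u" if "u \<in> lists G" for u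
    using that assms(1) by (induction u) (auto simp: \<psi>_def)
  have G: "\<psi> ` \<phi> ` G = G" using assms(1) by (simp add: \<psi>_def inv_into_image_cancel)
  have R: "map_prod (map \<psi>) (map \<psi>) ` map_prod (map \<phi>) (map \<phi>) ` R = R"
  proof -
    have "map_prod (map \<psi>) (map \<psi>) (map_prod (map \<phi>) (map \<phi>) r) = r" if "r \<in> R" for r
    proof (cases r)
      case (Pair u v)
      then have "u \<in> lists G" "v \<in> lists G" using that assms(2) by auto
      then show ?thesis using Pair inv by simp
    qed
    then show ?thesis by force
  qed
  show "pcong G R v w"
    using pcong_map[OF *, of \<psi>] inv[OF assms(3)] inv[OF assms(4)] unfolding G R by simp
qed (rule pcong_map)

lemma presented_inj:
  assumes "inj_on \<phi> G" "R \<subseteq> lists G \<times> lists G"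
    and "presented (\<phi> ` G) (map_prod (map \<phi>) (map \<phi>) ` R) q M"
  shows "presented G R (q \<circ> map \<phi>) M"
proof -
  interpret presented "\<phi> ` G" "map_prod (map \<phi>) (map \<phi>) ` R" q M by fact
  have in_lists: "map \<phi> w \<in> lists (\<phi> ` G)" if "w \<in> lists G" for w
    using that by auto
  show ?thesis
  proof
    show "carrier M = (q \<circ> map \<phi>) ` lists G"
      by (simp only: carrier_eq lists_image image_comp)
  qed (use in_lists q_append q_Nil q_eq_iff pcong_map_iff[OF assms(1,2)] in simp_all)
qed

lemma good_pres_map:
  assumes "good_pres g G R" "R \<subseteq> lists G \<times> lists G" "\<And>a. a \<in> G \<Longrightarrow> g' (\<phi> a) = g a"
  shows "good_pres g' (\<phi> ` G) (map_prod (map \<phi>) (map \<phi>) ` R)"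
proof -
  have g': "wgrade g' (map \<phi> w) = wgrade g w" if "w \<in> lists G" for w
    unfolding wgrade_map using that assms(3) by (intro wgrade_cong) auto
  show ?thesis
    unfolding good_pres_def
  proof (intro conjI ballI impI)
    fix v' w' assume "(v', w') \<in> map_prod (map \<phi>) (map \<phi>) ` R"
    then obtain v w where "(v, w) \<in> R" "v' = map \<phi> v" "w' = map \<phi> w" by auto
    moreover from this have "v \<in> lists G" "w \<in> lists G" using assms(2) by auto
    ultimately show "wgrade g' v' = wgrade g' w'"
      using g' assms(1) unfolding good_pres_def by metis
  next
    fix a' assume "a' \<in> \<phi> ` G" "g' a' = 0"
    then obtain a where a: "a \<in> G" "a' = \<phi> a" "g a = 0" using assms(3) by auto
    then obtain w where "pcong G R (a # w) []" "pcong G R (w @ [a]) []"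
      using assms(1) unfolding good_pres_def by metis
    from this[THEN pcong_map, of \<phi>]
    show "\<exists>w. pcong (\<phi> ` G) (map_prod (map \<phi>) (map \<phi>) ` R) (a' # w) [] \<and>
        pcong (\<phi> ` G) (map_prod (map \<phi>) (map \<phi>) ` R) (w @ [a']) []"
      using a(2) by (intro exI[of _ "map \<phi> w"]) simp
  next
    fix a' assume "a' \<in> \<phi> ` G"
    then obtain a where a: "a \<in> G" "a' = \<phi> a" by auto
    then obtain w where w: "\<forall>b\<in>set w. g b \<le> 1" "pcong G R [a] w"
      using assms(1) unfolding good_pres_def by metis
    have "w \<in> lists G" using w(2) pcong_lists by blast
    then have "\<forall>b\<in>set (map \<phi> w). g' b \<le> 1" using w(1) assms(3) by auto
    moreover have "pcong (\<phi> ` G) (map_prod (map \<phi>) (map \<phi>) ` R) [a'] (map \<phi> w)"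
      using pcong_map[OF w(2), of \<phi>] a(2) by simp
    ultimately show "\<exists>w. (\<forall>b\<in>set w. g' b \<le> 1) \<and>
        pcong (\<phi> ` G) (map_prod (map \<phi>) (map \<phi>) ` R) [a'] w" by blast
  qed
qed

text \<open>Letters are pairs of naturals, the second component being the degree.\<close>

definition fin_pres :: "((nat \<times> nat) set \<times> ((nat \<times> nat) list \<times> (nat \<times> nat) list) set) set" where
  "fin_pres = {(G, R). finite G \<and> finite R \<and> (\<forall>a\<in>G. snd a \<le> 2) \<and> good_pres snd G R}"

text \<open>With letters coded by natural numbers there are only countably many finite
  presentations. This is why the compact generators form a small set.\<close>

lemma countable_fin_pres: "countable fin_pres"
proof -
  have "countable ({G :: (nat \<times> nat) set. finite G} \<times>
      {R :: ((nat \<times> nat) list \<times> (nat \<times> nat) list) set. finite R})"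
    by (intro countable_SIGMA countable_Collect_finite)
  then show ?thesis by (rule countable_subset[rotated]) (auto simp: fin_pres_def)
qed

context small_universe
begin

text \<open>A presentation determines its monoid only up to isomorphism; one copy per presentation
  is chosen, so that the copies are indexed by \<open>fin_pres\<close>.\<close>

definition pres_obj :: "(nat \<times> nat) set \<times> ((nat \<times> nat) list \<times> (nat \<times> nat) list) set \<Rightarrow> 'u monoid" where
  "pres_obj = (\<lambda>(G, R). SOME M. small (carrier M) \<and> (\<exists>q. presented G R q M))"

lemma pres_obj:
  "small (carrier (pres_obj (G, R))) \<and> (\<exists>q. presented G R q (pres_obj (G, R)))"
proof -
  have "small_set small G" by (intro small_set_countable countableI_type)
  then have "\<exists>M. small (carrier M) \<and> (\<exists>q. presented G R q M)" by (metis ex_presented)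
  then show ?thesis unfolding pres_obj_def prod.case by (rule someI_ex)
qed

lemma small_set_pres_obj: "small_set small (pres_obj ` fin_pres)"
  using small_set_countable[OF countable_fin_pres] by (rule small_set_image)

lemma compact_pres_obj:
  assumes "P \<in> pres_obj ` fin_pres"
  shows "compact_object small (AtoMon small) P"
proof -
  from assms obtain G R where P: "P = pres_obj (G, R)" "finite G" "finite R" "\<forall>a\<in>G. snd a \<le> 2"
    "good_pres snd G R" by (auto simp: fin_pres_def)
  from pres_obj[of G R] P(1) obtain q where "presented G R q P" "small (carrier P)" by blast
  with P show ?thesis
    by (intro compact_presented[of G R q P snd])
      (auto simp: graded_presented_def graded_presented_axioms_def)
qed

text \<open>Letters of any type can be renamed to pairs of naturals, so every finite graded
  presentation is already presented by one of the chosen monoids.\<close>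

lemma ex_pres_obj:
  assumes "finite G" "finite R" "R \<subseteq> lists G \<times> lists G" "good_pres g G R" "\<And>a. a \<in> G \<Longrightarrow> g a \<le> 2"
  shows "\<exists>M q. M \<in> pres_obj ` fin_pres \<and> small (carrier M) \<and> presented G R q M"
proof -
  \<comment> \<open>The index makes the renaming injective; carrying the degree along turns
    \<open>g\<close> into \<open>snd\<close>.\<close>
  define \<phi> where "\<phi> a = (to_nat_on G a, g a)" for a
  have inj: "inj_on \<phi> G"
    using inj_on_to_nat_on[of G] assms(1) by (auto simp: \<phi>_def inj_on_def countable_finite)
  let ?R = "map_prod (map \<phi>) (map \<phi>) ` R"
  have "good_pres snd (\<phi> ` G) ?R"
    using assms(3,4) by (intro good_pres_map) (simp_all add: \<phi>_def)
  then have "(\<phi> ` G, ?R) \<in> fin_pres" using assms by (auto simp: fin_pres_def \<phi>_def)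
  moreover obtain q where "presented (\<phi> ` G) ?R q (pres_obj (\<phi> ` G, ?R))"
    using pres_obj by blast
  ultimately show ?thesis using presented_inj[OF inj assms(3)] pres_obj by blast
qed

end

section \<open>Every atomic monoid is a filtered colimit of finitely presented ones\<close>

text \<open>Since no letter has degree 2, adding relations that hold in \<open>X\<close> preserves \<open>good_pres\<close>.\<close>

definition stages :: "('u, 'b) monoid_scheme \<Rightarrow> ('u set \<times> ('u list \<times> 'u list) set) set" where
  "stages X = {(G, R). finite G \<and> finite R \<and> G \<subseteq> {x \<in> carrier X. grade X x \<le> 1} \<and>
     R \<subseteq> lists G \<times> lists G \<and> (\<forall>(v, w)\<in>R. mprod X v = mprod X w) \<and>
     good_pres (grade X) G R}"

text \<open>Homogeneity is automatic, since both sides of a relation have the same value in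
  \<open>H\<close> and hence the same degree. Each letter already is a word of degree at most 1, so
  only the invertibility of unit letters remains to be provided.\<close>

lemma (in atomic) good_presI:
  assumes "G \<subseteq> {x \<in> carrier H. grade H x \<le> 1}" "\<And>v w. (v, w) \<in> R \<Longrightarrow> mprod H v = mprod H w"
    and "\<And>a. a \<in> G \<Longrightarrow> a \<in> Units H \<Longrightarrow> \<exists>w. pcong G R (a # w) [] \<and> pcong G R (w @ [a]) []"
  shows "good_pres (grade H) G R"
  unfolding good_pres_def
proof (intro conjI ballI impI)
  have *: "grade H (mprod H u) = wgrade (grade H) u" if "u \<in> lists G" for u
    using that assms(1) by (subst grade_mprod) (auto simp: wgrade_def)
  fix v w assume vw: "v \<in> lists G" "w \<in> lists G" "(v, w) \<in> R"
  then show "wgrade (grade H) v = wgrade (grade H) w"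
    using *[OF vw(1)] *[OF vw(2)] assms(2)[OF vw(3)] by simp
next
  fix a assume "a \<in> G" "grade H a = 0"
  then show "\<exists>w. pcong G R (a # w) [] \<and> pcong G R (w @ [a]) []"
    using assms(3) by simp
next
  fix a assume "a \<in> G"
  then show "\<exists>w. (\<forall>b\<in>set w. grade H b \<le> 1) \<and> pcong G R [a] w"
    using assms(1) by (intro exI[of _ "[a]"]) (auto intro!: pcong.refl)
qed

text \<open>Unit letters stay invertible because congruences only grow. An empty \<open>S\<close>
  gives upper bounds of stages; a singleton \<open>S\<close> imposes one more equation that is true
  in \<open>H\<close>.\<close>

lemma (in atomic) stages_join:
  assumes "(G, R) \<in> stages H" "(G', R') \<in> stages H" "finite S"
    "S \<subseteq> lists (G \<union> G') \<times> lists (G \<union> G')" "\<And>v w. (v, w) \<in> S \<Longrightarrow> mprod H v = mprod H w"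
  shows "(G \<union> G', R \<union> R' \<union> S) \<in> stages H"
proof -
  have "good_pres (grade H) (G \<union> G') (R \<union> R' \<union> S)"
  proof (rule good_presI)
    fix a assume a: "a \<in> G \<union> G'" "a \<in> Units H"
    have "\<exists>w. pcong G0 R0 (a # w) [] \<and> pcong G0 R0 (w @ [a]) []"
      if "a \<in> G0" "(G0, R0) \<in> stages H" for G0 R0
      using that a(2) unfolding stages_def good_pres_def by simp
    with a(1) assms(1,2) obtain w G0 R0 where "pcong G0 R0 (a # w) []" "pcong G0 R0 (w @ [a]) []"
      "G0 \<subseteq> G \<union> G'" "R0 \<subseteq> R \<union> R' \<union> S"
      by blast
    then show "\<exists>w. pcong (G \<union> G') (R \<union> R' \<union> S) (a # w) [] \<and>
        pcong (G \<union> G') (R \<union> R' \<union> S) (w @ [a]) []"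
      using pcong_mono by blast
  qed (use assms in \<open>auto simp: stages_def\<close>)
  moreover have "R \<union> R' \<union> S \<subseteq> lists (G \<union> G') \<times> lists (G \<union> G')"
    using assms(1,2,4) lists_mono[of G "G \<union> G'"] lists_mono[of G' "G \<union> G'"]
    by (auto simp: stages_def)
  ultimately show ?thesis using assms(1,2,3,5) by (auto simp: stages_def)
qed

text \<open>A unit is accompanied by its inverse and the two relations between them; an atom needs
  no relation at all.\<close>

lemma (in atomic) stages_letter:
  assumes a: "a \<in> carrier H" "grade H a \<le> 1"
  shows "\<exists>G R. (G, R) \<in> stages H \<and> a \<in> G"
proof (cases "a \<in> Units H")
  case True
  define b where "b = inv a"
  have b: "b \<in> Units H" "b \<in> carrier H" "a \<otimes> b = \<one>" "b \<otimes> a = \<one>" using True by (auto simp: b_def)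
  let ?G = "{a, b}" and ?R = "{([a, b], []), ([b, a], [])}"
  have "good_pres (grade H) ?G ?R"
  proof (rule good_presI)
    have rel: "pcong ?G ?R [a, b] []" "pcong ?G ?R [b, a] []" by (auto intro!: pcong.rel)
    fix x assume "x \<in> ?G"
    then consider "x = a" | "x = b" by blast
    then show "\<exists>w. pcong ?G ?R (x # w) [] \<and> pcong ?G ?R (w @ [x]) []"
    proof cases
      case 1
      then show ?thesis using rel by (intro exI[of _ "[b]"]) simp
    next
      case 2
      then show ?thesis using rel by (intro exI[of _ "[a]"]) simp
    qed
  qed (use True a b in \<open>auto simp: grade_def\<close>)
  then have "(?G, ?R) \<in> stages H" using True a b by (auto simp: stages_def grade_def)
  then show ?thesis by blast
next
  case False
  then have "good_pres (grade H) {a} {}" using a by (intro good_presI) auto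
  then have "({a}, {}) \<in> stages H" using a by (auto simp: stages_def)
  then show ?thesis by blast
qed

lemma (in atomic) stages_empty: "({}, {}) \<in> stages H"
  by (simp add: stages_def good_pres_def)

lemma (in atomic) stages_word:
  assumes "set w \<subseteq> {x \<in> carrier H. grade H x \<le> 1}"
  shows "\<exists>G R. (G, R) \<in> stages H \<and> w \<in> lists G"
  using assms
proof (induction w)
  case Nil
  then show ?case using stages_empty by auto
next
  case (Cons a w)
  then obtain G R where 1: "(G, R) \<in> stages H" "w \<in> lists G" by auto
  obtain G' R' where 2: "(G', R') \<in> stages H" "a \<in> G'"
    using stages_letter[of a] Cons.prems by auto
  have "(G \<union> G', R \<union> R' \<union> {}) \<in> stages H" by (rule stages_join[OF 1(1) 2(1)]) auto
  moreover have "a # w \<in> lists (G \<union> G')" using 1 2 by auto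
  ultimately show ?case by blast
qed

section \<open>The directed system of stages, its colimit, and the size of hom-sets\<close>

context small_universe
begin

lemma small_set_stages:
  assumes "small (carrier X)"
  shows "small_set small (stages X)"
proof -
  let ?C = "carrier X"
  have "small_set small ?C" using assms by (rule small_set_small)
  then have "small_set small ({G. finite G \<and> G \<subseteq> ?C} \<times> {R. finite R \<and> R \<subseteq> lists ?C \<times> lists ?C})"
    by (intro small_set_Times small_set_finite_subsets small_set_lists)
  then show ?thesis
  proof (rule small_set_subset)
    show "stages X \<subseteq> {G. finite G \<and> G \<subseteq> ?C} \<times> {R. finite R \<and> R \<subseteq> lists ?C \<times> lists ?C}"
      unfolding stages_def by fastforce
  qed
qed

text \<open>Every element of \<open>X\<close> is the value of a word over some stage, and every
  equation between words that holds in \<open>X\<close> is a relation of some larger stage. These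
  two facts make \<open>X\<close> the colimit of its stages.\<close>

lemma ex_filtered_presentation:
  assumes X: "atomic X" "small (carrier X)"
  shows "\<exists>(J :: ('u, 'u) cat) D c. small_cat small J \<and> filtered J \<and>
    is_functor J (AtoMon small) D \<and> (\<forall>j\<in>Obj J. omap D j \<in> pres_obj ` fin_pres) \<and>
    is_colimit J (AtoMon small) D X c"
proof -
  interpret X: atomic X by fact
  let ?g = "grade X"
  \<comment> \<open>The index category must live in \<open>'u\<close>, so stages are indexed by
    codes. Distinct codes may name the same stage, and the order defined on them below is in general
    only a preorder.\<close>
  obtain U :: "'u set" and dec where U: "small U" "stages X = dec ` U"
    using small_set_stages[OF X(2)] unfolding small_set_def by blast
  define G where "G u = fst (dec u)" for u
  define R where "R u = snd (dec u)" for u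
  have stage: "(G u, R u) \<in> stages X" if "u \<in> U" for u
    using U(2) that by (simp add: G_def R_def)
  have stageE: "\<exists>u\<in>U. G u = G' \<and> R u = R'" if "(G', R') \<in> stages X" for G' R'
    using that unfolding U(2) G_def R_def by (metis fst_conv snd_conv imageE)
  have "\<exists>M q. M \<in> pres_obj ` fin_pres \<and> small (carrier M) \<and> presented (G u) (R u) q M"
    if "u \<in> U" for u
    using stage[OF that] grade_le[of X] by (intro ex_pres_obj[where g = ?g]) (auto simp: stages_def)
  then obtain M q where M: "\<And>u. u \<in> U \<Longrightarrow> M u \<in> pres_obj ` fin_pres"
    "\<And>u. u \<in> U \<Longrightarrow> small (carrier (M u))" "\<And>u. u \<in> U \<Longrightarrow> presented (G u) (R u) (q u) (M u)"
    by metis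
  have gp: "graded_presented (G u) (R u) (q u) (M u) ?g" if "u \<in> U" for u
    using M(3)[OF that] stage[OF that]
    by (auto simp: graded_presented_def graded_presented_axioms_def stages_def)
  note atomic_M = graded_presented.atomic[OF gp]
  note grade_q = graded_presented.grade_q[OF gp]
  note hom_eqI = presented.hom_eqI[OF M(3)]
  note q_carrier = presented.q_carrier[OF M(3)]
  have G_le: "grade X a \<le> 1" "a \<in> carrier X" if "u \<in> U" "a \<in> G u" for u a
    using stage[OF that(1)] that(2) by (auto simp: stages_def)
  have set_carrier: "set w \<subseteq> carrier X" if "u \<in> U" "w \<in> lists (G u)" for u w
    using that G_le by auto
  have grade_mprod: "wgrade ?g w = ?g (mprod X w)" if "u \<in> U" "w \<in> lists (G u)" for u w
    using X.grade_mprod[OF set_carrier[OF that]] by (simp add: wgrade_def)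

  define le where "le u v \<longleftrightarrow> G u \<subseteq> G v \<and> R u \<subseteq> R v" for u v
  have le_lists: "w \<in> lists (G v)" if "le u v" "w \<in> lists (G u)" for u v w
    using that by (auto simp: le_def)
  have "\<exists>h. h \<in> atom_hom (M u) (M v) \<and> (\<forall>w\<in>lists (G u). h (q u w) = q v w)"
    if uv: "u \<in> U" "v \<in> U" "le u v" for u v
  proof -
    interpret v: graded_presented "G v" "R v" "q v" "M v" ?g using gp uv by blast
    have word: "mprod (M v) (map (\<lambda>a. q v [a]) w) = q v w" if "w \<in> lists (G u)" for w
      using v.mprod_q[OF le_lists[OF uv(3) that]] .
    obtain h where "h \<in> atom_hom (M u) (M v)"
      "\<And>w. w \<in> lists (G u) \<Longrightarrow> h (q u w) = mprod (M v) (map (\<lambda>a. q v [a]) w)"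
    proof (rule graded_presented.lift[OF gp[OF uv(1)] v.atomic, of "\<lambda>a. q v [a]"])
      fix a assume a: "a \<in> G u"
      then have "a \<in> G v" using uv(3) by (auto simp: le_def)
      then show "q v [a] \<in> carrier (M v)" "grade (M v) (q v [a]) = ?g a"
        using v.q_carrier v.grade_q[of "[a]"] grade_le[of X a] by (simp_all add: wgrade_def)
    next
      fix w w' assume w: "(w, w') \<in> R u" "w \<in> lists (G u)" "w' \<in> lists (G u)"
      then have "pcong (G v) (R v) w w'"
        using uv(3) le_lists[OF uv(3)] by (intro pcong.rel) (auto simp: le_def)
      then have "q v w = q v w'" using v.q_eq_iff pcong_lists by blast
      then show "mprod (M v) (map (\<lambda>a. q v [a]) w) = mprod (M v) (map (\<lambda>a. q v [a]) w')"
        using word w by simp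
    qed (rule that)
    then show ?thesis using word by auto
  qed
  then obtain tr where tr: "\<And>u v. u \<in> U \<Longrightarrow> v \<in> U \<Longrightarrow> le u v \<Longrightarrow> tr u v \<in> atom_hom (M u) (M v)"
    "\<And>u v w. u \<in> U \<Longrightarrow> v \<in> U \<Longrightarrow> le u v \<Longrightarrow> w \<in> lists (G u) \<Longrightarrow> tr u v (q u w) = q v w"
    by metis
  have "\<exists>h. h \<in> atom_hom (M u) X \<and> (\<forall>w\<in>lists (G u). h (q u w) = mprod X w)" if u: "u \<in> U" for u
  proof -
    obtain h where "h \<in> atom_hom (M u) X"
      "\<And>w. w \<in> lists (G u) \<Longrightarrow> h (q u w) = mprod X (map (\<lambda>a. a) w)"
    proof (rule graded_presented.lift[OF gp[OF u] X(1), of "\<lambda>a. a"])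
      fix v w assume "(v, w) \<in> R u"
      then show "mprod X (map (\<lambda>a. a) v) = mprod X (map (\<lambda>a. a) w)"
        using stage[OF u] by (auto simp: stages_def)
    qed (use G_le u in auto)
    then show ?thesis by auto
  qed
  then obtain c where c: "\<And>u. u \<in> U \<Longrightarrow> c u \<in> atom_hom (M u) X"
    "\<And>u w. u \<in> U \<Longrightarrow> w \<in> lists (G u) \<Longrightarrow> c u (q u w) = mprod X w"
    by metis

  have join: "\<exists>k\<in>U. le u k \<and> le v k \<and> S \<subseteq> R k"
    if "u \<in> U" "v \<in> U" "finite S" "S \<subseteq> lists (G u \<union> G v) \<times> lists (G u \<union> G v)"
      "\<And>w w'. (w, w') \<in> S \<Longrightarrow> mprod X w = mprod X w'" for u v S
  proof -
    have "(G u \<union> G v, R u \<union> R v \<union> S) \<in> stages X"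
      using X.stages_join stage that by blast
    from stageE[OF this] obtain k where "k \<in> U" "G k = G u \<union> G v" "R k = R u \<union> R v \<union> S"
      by blast
    then show ?thesis by (intro bexI[of _ k]) (auto simp: le_def)
  qed
  have join': "\<exists>k\<in>U. le u k \<and> le v k" if "u \<in> U" "v \<in> U" for u v
    using join[OF that, of "{}"] by blast

  \<comment> \<open>The preorder \<open>le\<close> as a category; \<open>undefined\<close> is the
    unique arrow wherever one exists.\<close>
  define J :: "('u, 'u) cat" where
    "J = \<lparr>Obj = U, Hom = (\<lambda>u v. if le u v then {undefined} else {}),
      idt = (\<lambda>_. undefined), cmp = (\<lambda>_ _ _ _ _. undefined)\<rparr>"
  define D :: "('u, 'u, 'u monoid, 'u \<Rightarrow> 'u) ftor" where
    "D = \<lparr>omap = M, amap = (\<lambda>u v _. tr u v)\<rparr>"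
  have J_simps [simp]: "Obj J = U" "f \<in> Hom J u v \<longleftrightarrow> le u v \<and> f = undefined"
    "Hom J u v = (if le u v then {undefined} else {})"
    "idt J u = undefined" "cmp J u v w f' g' = undefined" for f u v w f' g'
    by (simp_all add: J_def)
  have D_simps [simp]: "omap D u = M u" "amap D u v f = tr u v" for u v f
    by (simp_all add: D_def)
  have le_refl: "le u u" and le_trans: "le u v \<Longrightarrow> le v w \<Longrightarrow> le u w" for u v w
    by (auto simp: le_def)
  have cat: "category J"
    unfolding category_def by (auto simp: le_refl split: if_splits intro: le_trans)
  have "U \<noteq> {}" using X.stages_empty U(2) by auto
  have "small_cat small J"
    using cat U(1) small_singleton small_subset[OF small_singleton, of "{}"]
    by (simp add: small_cat_def)
  moreover have "filtered J"
    unfolding filtered_def using cat \<open>U \<noteq> {}\<close> join' le_refl by (fastforce split: if_splits)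
  moreover have "is_functor J (AtoMon small) D"
    unfolding is_functor_def
  proof (intro conjI ballI)
    fix u assume "u \<in> Obj J"
    then have u: "u \<in> U" by simp
    show "omap D u \<in> Obj (AtoMon small)" using atomic_M M u by simp
    have "tr u u = (\<lambda>x\<in>carrier (M u). x)"
    proof (rule hom_eqI[OF u])
      show "(\<lambda>x\<in>carrier (M u). x) \<in> atom_hom (M u) (M u)"
        using atom_hom_id atomic_imp_monoid atomic_M u by blast
    qed (use tr le_refl u q_carrier in auto)
    then show "amap D u u (idt J u) = idt (AtoMon small) (omap D u)" by simp
  next
    fix u v f assume "u \<in> Obj J" "v \<in> Obj J" "f \<in> Hom J u v"
    then show "amap D u v f \<in> Hom (AtoMon small) (omap D u) (omap D v)"
      using tr(1) by (simp split: if_splits)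
  next
    fix u v w f g
    assume "u \<in> Obj J" "v \<in> Obj J" "w \<in> Obj J" "f \<in> Hom J u v" "g \<in> Hom J v w"
    then have uvw: "u \<in> U" "v \<in> U" "w \<in> U" "le u v" "le v w" by (simp_all split: if_splits)
    have uw: "le u w" using le_trans uvw by blast
    have "tr u w = compose (carrier (M u)) (tr v w) (tr u v)"
    proof (rule hom_eqI[OF uvw(1)])
      show "tr u w \<in> atom_hom (M u) (M w)" using tr(1) uvw uw by blast
      show "compose (carrier (M u)) (tr v w) (tr u v) \<in> atom_hom (M u) (M w)"
        using atom_hom_compose tr(1) uvw atomic_imp_monoid atomic_M by blast
      fix a assume a: "a \<in> G u"
      then have "[a] \<in> lists (G u)" "[a] \<in> lists (G v)" using uvw(4) by (auto simp: le_def)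
      then show "tr u w (q u [a]) = compose (carrier (M u)) (tr v w) (tr u v) (q u [a])"
        using tr(2) uvw uw q_carrier[OF uvw(1)] by (simp add: compose_def)
    qed
    then show "amap D u w (cmp J u v w g f) =
        cmp (AtoMon small) (omap D u) (omap D v) (omap D w) (amap D v w g) (amap D u v f)"
      by simp
  qed (use cat category_AtoMon in auto)
  moreover have "\<forall>u\<in>Obj J. omap D u \<in> pres_obj ` fin_pres" using M(1) by simp
  moreover have "is_colimit J (AtoMon small) D X c"
    unfolding is_colimit_def
  proof (intro conjI allI impI)
    show "is_cocone J (AtoMon small) D X c"
      unfolding is_cocone_def
    proof (intro conjI ballI)
      show "X \<in> Obj (AtoMon small)" using X by simp
      show "c u \<in> Hom (AtoMon small) (omap D u) X" if "u \<in> Obj J" for u using that c(1) by simp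
      fix u v f assume "u \<in> Obj J" "v \<in> Obj J" "f \<in> Hom J u v"
      then have uv: "u \<in> U" "v \<in> U" "le u v" by (simp_all split: if_splits)
      have "compose (carrier (M u)) (c v) (tr u v) = c u"
      proof (rule hom_eqI[OF uv(1)])
        show "compose (carrier (M u)) (c v) (tr u v) \<in> atom_hom (M u) X"
          using atom_hom_compose tr(1) c(1) uv atomic_imp_monoid atomic_M by blast
        show "c u \<in> atom_hom (M u) X" using c(1) uv by blast
        fix a assume a: "a \<in> G u"
        then have "[a] \<in> lists (G u)" "[a] \<in> lists (G v)" using uv(3) by (auto simp: le_def)
        then show "compose (carrier (M u)) (c v) (tr u v) (q u [a]) = c u (q u [a])"
          using tr(2) c(2) uv q_carrier[OF uv(1)] by (simp add: compose_def)
      qed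
      then show "cmp (AtoMon small) (omap D u) (omap D v) X (c v) (amap D u v f) = c u" by simp
    qed
  next
    fix T t assume cocone: "is_cocone J (AtoMon small) D T t"
    have T: "atomic T" and t: "\<And>u. u \<in> U \<Longrightarrow> t u \<in> atom_hom (M u) T"
      using cocone unfolding is_cocone_def by simp_all
    have t_tr: "t v (q v w) = t u (q u w)"
      if uv: "u \<in> U" "v \<in> U" "le u v" and w: "w \<in> lists (G u)" for u v w
    proof -
      have "compose (carrier (M u)) (t v) (tr u v) = t u"
        using cocone uv unfolding is_cocone_def by simp
      from fun_cong[OF this, of "q u w"] show ?thesis
        using tr(2) uv w q_carrier[OF uv(1) w] by (simp add: compose_def)
    qed
    have welldef: "t u (q u w) = t v (q v w')"
      if u: "u \<in> U" "w \<in> lists (G u)" and v: "v \<in> U" "w' \<in> lists (G v)"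
        and eq: "mprod X w = mprod X w'" for u v w w'
    proof -
      \<comment> \<open>The equation between \<open>w\<close> and \<open>w'\<close> holds in
        \<open>X\<close>, so it may itself be adjoined as a relation of a larger stage, where the
        two classes coincide.\<close>
      have "\<exists>k\<in>U. le u k \<and> le v k \<and> {(w, w')} \<subseteq> R k"
        using u v eq by (intro join) auto
      then obtain k where k: "k \<in> U" "le u k" "le v k" "(w, w') \<in> R k" by blast
      have "w \<in> lists (G k)" "w' \<in> lists (G k)" using le_lists k u v by blast+
      then have "q k w = q k w'"
        using presented.q_eq_iff[OF M(3)[OF k(1)]] pcong.rel[OF k(4)] by blast
      then show ?thesis using t_tr[of u k w] t_tr[of v k w'] k u v by simp
    qed
    have cover: "\<exists>u\<in>U. \<exists>w\<in>lists (G u). mprod X w = x" if x: "x \<in> carrier X" for x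
    proof -
      obtain w where w: "set w \<subseteq> {a \<in> carrier X. grade X a \<le> 1}" "mprod X w = x"
        using X.ex_mprod_eq[OF x] .
      then show ?thesis using X.stages_word[OF w(1)] stageE by metis
    qed
    \<comment> \<open>The mediating map sends the value of a word in \<open>X\<close> to the value
      of its class under the cocone; \<open>welldef\<close> makes the stage and the word
      irrelevant.\<close>
    define h where
      "h = (\<lambda>x\<in>carrier X. SOME z. \<exists>u\<in>U. \<exists>w\<in>lists (G u). mprod X w = x \<and> z = t u (q u w))"
    have h: "h (mprod X w) = t u (q u w)" if u: "u \<in> U" "w \<in> lists (G u)" for u w
    proof -
      have "(SOME z. \<exists>v\<in>U. \<exists>w'\<in>lists (G v). mprod X w' = mprod X w \<and> z = t v (q v w')) = t u (q u w)"
        by (rule some_equality) (use u welldef in metis)+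
      then show ?thesis using X.mprod_closed[OF set_carrier[OF u]] by (simp add: h_def)
    qed
    have "restrict h (carrier X) \<in> atom_hom X T"
    proof (rule atom_homI[OF X(1) T])
      fix x assume x: "x \<in> carrier X"
      then obtain u w where u: "u \<in> U" "w \<in> lists (G u)" "mprod X w = x" using cover by blast
      show "h x \<in> carrier T" using h u atom_hom_carrier[OF t q_carrier] by metis
      have "grade T (h x) = grade (M u) (q u w)"
        using h u atom_hom_grade[OF atomic_M T t q_carrier] by metis
      also have "\<dots> = ?g x" using grade_q grade_mprod u by metis
      finally show "grade T (h x) = ?g x" .
    next
      fix x y assume "x \<in> carrier X" "y \<in> carrier X"
      then obtain u w v w' where u: "u \<in> U" "w \<in> lists (G u)" "mprod X w = x"
        and v: "v \<in> U" "w' \<in> lists (G v)" "mprod X w' = y" using cover by metis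
      \<comment> \<open>Multiplicativity is checked at a common stage, where both words are
        available and their product is the class of the concatenation.\<close>
      obtain k where k: "k \<in> U" "le u k" "le v k" using join' u v by blast
      have ww': "w \<in> lists (G k)" "w' \<in> lists (G k)" using le_lists k u v by blast+
      have "x \<otimes>\<^bsub>X\<^esub> y = mprod X (w @ w')"
        using X.mprod_append set_carrier k ww' u v by metis
      then have "h (x \<otimes>\<^bsub>X\<^esub> y) = t k (q k (w @ w'))" using h[OF k(1), of "w @ w'"] ww' by simp
      also have "\<dots> = t k (q k w) \<otimes>\<^bsub>T\<^esub> t k (q k w')"
        using presented.q_append[OF M(3)[OF k(1)] ww'] atom_hom_mult[OF t] q_carrier k ww' by metis
      also have "\<dots> = h x \<otimes>\<^bsub>T\<^esub> h y" using h[OF k(1)] ww' u v by metis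
      finally show "h (x \<otimes>\<^bsub>X\<^esub> y) = h x \<otimes>\<^bsub>T\<^esub> h y" .
    next
      obtain u where u: "u \<in> U" using \<open>U \<noteq> {}\<close> by blast
      have "t u (q u []) = \<one>\<^bsub>T\<^esub>"
        using presented.q_Nil[OF M(3)[OF u]] atom_hom_one[OF t[OF u]] by simp
      then show "h \<one>\<^bsub>X\<^esub> = \<one>\<^bsub>T\<^esub>" using h[OF u, of "[]"] by simp
    qed
    then have h_hom: "h \<in> atom_hom X T" by (simp add: h_def)
    show "\<exists>!h. h \<in> Hom (AtoMon small) X T \<and>
        (\<forall>u\<in>Obj J. cmp (AtoMon small) (omap D u) X T h (c u) = t u)"
    proof (rule ex1I[of _ h])
      have "compose (carrier (M u)) h (c u) = t u" if u: "u \<in> U" for u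
      proof (rule hom_eqI[OF u])
        show "compose (carrier (M u)) h (c u) \<in> atom_hom (M u) T"
          using atom_hom_compose h_hom c(1) u atomic_imp_monoid atomic_M by blast
        show "t u \<in> atom_hom (M u) T" using t u .
        fix a assume a: "a \<in> G u"
        then show "compose (carrier (M u)) h (c u) (q u [a]) = t u (q u [a])"
          using c(2)[OF u, of "[a]"] h[OF u, of "[a]"] q_carrier[OF u, of "[a]"]
          by (simp add: compose_def)
      qed
      then show "h \<in> Hom (AtoMon small) X T \<and>
          (\<forall>u\<in>Obj J. cmp (AtoMon small) (omap D u) X T h (c u) = t u)"
        using h_hom by simp
      fix k assume k: "k \<in> Hom (AtoMon small) X T \<and>
          (\<forall>u\<in>Obj J. cmp (AtoMon small) (omap D u) X T k (c u) = t u)"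
      show "k = h"
      proof (rule atom_hom_eqI)
        show "k \<in> atom_hom X T" "h \<in> atom_hom X T" using k h_hom by simp_all
        fix x assume "x \<in> carrier X"
        then obtain u w where u: "u \<in> U" "w \<in> lists (G u)" "mprod X w = x" using cover by blast
        then have "compose (carrier (M u)) k (c u) (q u w) = t u (q u w)" using k by simp
        then show "k x = h x"
          using u h[OF u(1,2)] c(2)[OF u(1,2)] q_carrier[OF u(1,2)] by (simp add: compose_def)
      qed
    qed
  qed
  ultimately show ?thesis by blast
qed

lemma locally_finitely_presentable_AtoMon:
  "locally_finitely_presentable small (AtoMon small)"
  unfolding locally_finitely_presentable_def
proof (intro conjI exI[of _ "pres_obj ` fin_pres"] ballI)
  fix X assume "X \<in> Obj (AtoMon small)"
  then show "\<exists>(J :: ('u, 'u) cat) D c. small_cat small J \<and> filtered J \<and>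
      is_functor J (AtoMon small) D \<and> (\<forall>j\<in>Obj J. omap D j \<in> pres_obj ` fin_pres) \<and>
      is_colimit J (AtoMon small) D X c"
    using ex_filtered_presentation by simp
qed (fact category_AtoMon cocomplete_AtoMon small_set_pres_obj compact_pres_obj)+

text \<open>A homomorphism is recovered from its graph, a subset of a small set of pairs; hence
  closure under power sets bounds the hom-set.\<close>

lemma locally_small_AtoMon:
  assumes "power_closed small"
  shows "locally_small small (AtoMon small)"
  unfolding locally_small_def
proof (intro ballI)
  fix H K assume "H \<in> Obj (AtoMon small)" "K \<in> Obj (AtoMon small)"
  then have "small_set small (carrier H \<times> carrier K)"
    by (intro small_set_Times small_set_small) simp_all
  then obtain A f where A: "small A" "carrier H \<times> carrier K = f ` A"
    unfolding small_set_def by blast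
  have "small_set small (Pow A)" using assms A(1) unfolding power_closed_def by blast
  moreover have "atom_hom H K \<subseteq> (\<lambda>B. \<lambda>x\<in>carrier H. THE y. (x, y) \<in> f ` B) ` Pow A"
  proof
    fix h assume h: "h \<in> atom_hom H K"
    \<comment> \<open>\<open>A\<close> enumerates the pairs through \<open>f\<close>, possibly with
      repetitions, so the graph of \<open>h\<close> is represented by the set of all its
      codes.\<close>
    define B where "B = {a \<in> A. snd (f a) = h (fst (f a))}"
    have B: "(x, y) \<in> f ` B \<longleftrightarrow> y = h x" if x: "x \<in> carrier H" for x y
    proof
      assume "y = h x"
      then have "(x, y) \<in> f ` A" using x atom_hom_carrier[OF h] A(2) by blast
      then obtain a where a: "a \<in> A" "f a = (x, y)" by force
      then have "a \<in> B" using \<open>y = h x\<close> by (simp add: B_def)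
      then show "(x, y) \<in> f ` B" using a(2) by force
    next
      assume "(x, y) \<in> f ` B"
      then obtain a where "a \<in> B" "f a = (x, y)" by force
      then show "y = h x" by (simp add: B_def)
    qed
    have "h = (\<lambda>x\<in>carrier H. THE y. (x, y) \<in> f ` B)"
    proof (rule extensionalityI)
      show "h \<in> extensional (carrier H)" using h by (simp add: atom_hom_def)
    qed (use B in simp_all)
    moreover have "B \<in> Pow A" by (auto simp: B_def)
    ultimately show "h \<in> (\<lambda>B. \<lambda>x\<in>carrier H. THE y. (x, y) \<in> f ` B) ` Pow A" by blast
  qed
  ultimately have "small_set small (atom_hom H K)" by (rule small_set_surj)
  then show "small_set small (Hom (AtoMon small) H K)" by simp
qed

end

theorem theorem2p6:
  fixes small :: "'u set \<Rightarrow> bool"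
  assumes "smallness small"
  shows "locally_finitely_presentable small (AtoMon small) \<and>
         (power_closed small \<longrightarrow> locally_small small (AtoMon small))"
proof -
  interpret small_universe small by unfold_locales (rule assms)
  show ?thesis using locally_finitely_presentable_AtoMon locally_small_AtoMon by blast
qed

end
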